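(* Let $\mathbf A\in\mathbb H^{m\times n}$, $\mathbf y\in\mathbb H^{m\times 1}$, and let $\mathbf x^{0}=(x^0_1,\dots,x^0_n)^T$ be the least squares solution of least norm of the right system $\mathbf A\mathbf x=\mathbf y$. Put $\mathbf f=\mathbf A^{*}\mathbf y$. (i) If $\operatorname{rank}\mathbf A=n$, then for all $j=1,\dots,n$, $x_j^0=\dfrac{\operatorname{cdet}_j\big((\mathbf A^{*}\mathbf A)_{.j}(\mathbf f)\big)}{\operatorname{ddet}\mathbf A}$. (ii) If $\operatorname{rank}\mathbf A=k\le m<n$, then for all $j=1,\dots,n$, $x_j^0=\dfrac{\sum_{\beta\in J_{k,n}\{j\}}\operatorname{cdet}_j\Big(\big((\mathbf A^{*}\mathbf A)_{.j}(\mathbf f)\big)^{\beta}_{\beta}\Big)}{\sum_{\beta\in J_{k,n}}\big|(\mathbf A^{*}\mathbf A)^{\beta}_{\beta}\big|}$.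
   Context: $\mathbb H$ is the quaternion skew field, $\mathbf A^*$ the conjugate transpose. The rank of a quaternion matrix is the maximal number of right-linearly independent columns. For $\mathbf x\in\mathbb H^{n\times1}$, $\|\mathbf x\|=\sqrt{\mathbf x^*\mathbf x}$. The least squares solution of least norm of $\mathbf A\mathbf x=\mathbf y$ is the vector $\mathbf x^0$ of minimal norm among all $\tilde{\mathbf x}$ minimizing $\|\mathbf A\tilde{\mathbf x}-\mathbf y\|$. $\operatorname{ddet}\mathbf A:=\det(\mathbf A^*\mathbf A)$. Row and column determinants of $\mathbf M=(m_{ij})\in\mathbb H^{n\times n}$: $\operatorname{rdet}_i\mathbf M=\sum_{\sigma\in S_n}(-1)^{n-r}m_{i\,i_{k_1}}m_{i_{k_1}i_{k_1+1}}\cdots m_{i_{k_1+l_1}\,i}\cdots m_{i_{k_r}i_{k_r+1}}\cdots m_{i_{k_r+l_r}i_{k_r}}$ with $\sigma=(i\,i_{k_1}\dots i_{k_1+l_1})(i_{k_2}\dots i_{k_2+l_2})\cdots(i_{k_r}\dots i_{k_r+l_r})$ its decomposition into $r$ disjoint cycles (fixed points included), first cycle starting with $i$, other cycles starting with their smallest element, $i_{k_2}<\dots<i_{k_r}$; $\operatorname{cdet}_j\mathbf M=\sum_{\tau\in S_n}(-1)^{n-r}m_{j_{k_r}j_{k_r+l_r}}\cdots m_{j_{k_r+1}j_{k_r}}\cdots m_{j\,j_{k_1+l_1}}\cdots m_{j_{k_1+1}j_{k_1}}m_{j_{k_1}j}$ with $\tau=(j_{k_r+l_r}\dots j_{k_r})\cdots(j_{k_2+l_2}\dots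 j_{k_2})(j_{k_1+l_1}\dots j_{k_1}\,j)$, the rightmost cycle ending with $j$, other cycles ending on the right with their smallest element, $j_{k_2}<\dots<j_{k_r}$. For Hermitian $\mathbf M$ all these coincide and are real; the common value is $\det\mathbf M$. $\mathbf M_{.j}(\mathbf f)$ is $\mathbf M$ with its $j$th column replaced by $\mathbf f$. $L_{k,n}$ is the set of strictly increasing $k$-sequences from $\{1,\dots,n\}$, $J_{k,n}=L_{k,n}$, $J_{k,n}\{j\}=\{\beta\in L_{k,n}: j\in\beta\}$. $\mathbf M^{\beta}_{\beta}$ is the principal submatrix with rows and columns in $\beta$; $|\mathbf M^\beta_\beta|=\det\mathbf M^\beta_\beta$ for Hermitian $\mathbf M$. In $\operatorname{cdet}_j(\mathbf N^\beta_\beta)$, $j\in\beta$, the subscript refers to the column of the submatrix coming from column $j$ of $\mathbf N$. *)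

theory Defs
  imports Complex_Main "HOL-Combinatorics.Permutations"
begin

datatype quat = Quat (qre: real) (qi: real) (qj: real) (qk: real)

lemma quat_eqI: "qre a = qre b \<Longrightarrow> qi a = qi b \<Longrightarrow> qj a = qj b \<Longrightarrow> qk a = qk b \<Longrightarrow> a = b"
  by (cases a; cases b) simp

instantiation quat :: ring_1
begin
definition "0 = Quat 0 0 0 0"
definition "1 = Quat 1 0 0 0"
definition "a + b = Quat (qre a + qre b) (qi a + qi b) (qj a + qj b) (qk a + qk b)"
definition "a - b = Quat (qre a - qre b) (qi a - qi b) (qj a - qj b) (qk a - qk b)"
definition "- a = Quat (- qre a) (- qi a) (- qj a) (- qk a)"
definition "a * b = Quat
   (qre a * qre b - qi a * qi b - qj a * qj b - qk a * qk b)
   (qre a * qi b + qi a * qre b + qj a * qk b - qk a * qj b)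
   (qre a * qj b - qi a * qk b + qj a * qre b + qk a * qi b)
   (qre a * qk b + qi a * qj b - qj a * qi b + qk a * qre b)"
instance
  by standard (auto intro!: quat_eqI simp: zero_quat_def one_quat_def plus_quat_def
      minus_quat_def uminus_quat_def times_quat_def algebra_simps)
end

definition qcnj :: "quat \<Rightarrow> quat" where
  "qcnj a = Quat (qre a) (- qi a) (- qj a) (- qk a)"

definition qnormsq :: "quat \<Rightarrow> real" where
  "qnormsq a = (qre a)\<^sup>2 + (qi a)\<^sup>2 + (qj a)\<^sup>2 + (qk a)\<^sup>2"

text \<open>Division in the skew field H (right division a b^-1; b^-1 = conj b / |b|^2, 0^-1 = 0).\<close>
definition qinv :: "quat \<Rightarrow> quat" where
  "qinv b = (let s = (if qnormsq b = 0 then 0 else 1 / qnormsq b)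
             in Quat (s * qre b) (- s * qi b) (- s * qj b) (- s * qk b))"

definition qdiv :: "quat \<Rightarrow> quat \<Rightarrow> quat" where
  "qdiv a b = a * qinv b"

text \<open>An m x n quaternion matrix is a function nat => nat => quat, with rows
  indexed by 0..<m and columns by 0..<n (0-based indices); vectors are nat => quat.\<close>

definition conj_transpose :: "(nat \<Rightarrow> nat \<Rightarrow> quat) \<Rightarrow> (nat \<Rightarrow> nat \<Rightarrow> quat)" where
  "conj_transpose A = (\<lambda>i j. qcnj (A j i))"

definition mat_mult :: "nat \<Rightarrow> (nat \<Rightarrow> nat \<Rightarrow> quat) \<Rightarrow> (nat \<Rightarrow> nat \<Rightarrow> quat) \<Rightarrow> (nat \<Rightarrow> nat \<Rightarrow> quat)" where
  "mat_mult l A B = (\<lambda>i j. \<Sum>t<l. A i t * B t j)"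

definition mat_vec :: "nat \<Rightarrow> (nat \<Rightarrow> nat \<Rightarrow> quat) \<Rightarrow> (nat \<Rightarrow> quat) \<Rightarrow> (nat \<Rightarrow> quat)" where
  "mat_vec n A x = (\<lambda>i. \<Sum>j<n. A i j * x j)"

definition vnorm :: "nat \<Rightarrow> (nat \<Rightarrow> quat) \<Rightarrow> real" where
  "vnorm n x = sqrt (\<Sum>i<n. qnormsq (x i))"

definition is_lsq_solution :: "nat \<Rightarrow> nat \<Rightarrow> (nat \<Rightarrow> nat \<Rightarrow> quat) \<Rightarrow> (nat \<Rightarrow> quat) \<Rightarrow> (nat \<Rightarrow> quat) \<Rightarrow> bool" where
  "is_lsq_solution m n A y x \<longleftrightarrow>
     (\<forall>z. vnorm m (\<lambda>i. mat_vec n A x i - y i) \<le> vnorm m (\<lambda>i. mat_vec n A z i - y i))"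

definition is_lsq_least_norm :: "nat \<Rightarrow> nat \<Rightarrow> (nat \<Rightarrow> nat \<Rightarrow> quat) \<Rightarrow> (nat \<Rightarrow> quat) \<Rightarrow> (nat \<Rightarrow> quat) \<Rightarrow> bool" where
  "is_lsq_least_norm m n A y x \<longleftrightarrow> is_lsq_solution m n A y x \<and>
     (\<forall>z. is_lsq_solution m n A y z \<longrightarrow> vnorm n x \<le> vnorm n z)"

definition right_lin_indep_cols :: "nat \<Rightarrow> (nat \<Rightarrow> nat \<Rightarrow> quat) \<Rightarrow> nat set \<Rightarrow> bool" where
  "right_lin_indep_cols m A S \<longleftrightarrow>
     (\<forall>\<alpha>. (\<forall>i<m. (\<Sum>j\<in>S. A i j * \<alpha> j) = 0) \<longrightarrow> (\<forall>j\<in>S. \<alpha> j = 0))"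

definition qrank :: "nat \<Rightarrow> nat \<Rightarrow> (nat \<Rightarrow> nat \<Rightarrow> quat) \<Rightarrow> nat" where
  "qrank m n A = Max {card S | S. S \<subseteq> {..<n} \<and> right_lin_indep_cols m A S}"

definition repl_col :: "(nat \<Rightarrow> nat \<Rightarrow> quat) \<Rightarrow> nat \<Rightarrow> (nat \<Rightarrow> quat) \<Rightarrow> (nat \<Rightarrow> nat \<Rightarrow> quat)" where
  "repl_col M j f = (\<lambda>a b. if b = j then f a else M a b)"

text \<open>Determinants are taken of the square matrix M restricted to a finite index set
  I of naturals (rows and columns in I, in increasing order). With I = {..<n} this is
  an n x n matrix; with I = beta it is the principal submatrix M^beta_beta, and
  index j of I refers to the column coming from column j of M.\<close>

definition cyc_len :: "(nat \<Rightarrow> nat) \<Rightarrow> nat \<Rightarrow> nat" where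
  "cyc_len p s = (LEAST t. 0 < t \<and> (p ^^ t) s = s)"

definition cyc_prod :: "(nat \<Rightarrow> nat \<Rightarrow> quat) \<Rightarrow> (nat \<Rightarrow> nat) \<Rightarrow> nat \<Rightarrow> quat" where
  "cyc_prod M p s = prod_list (map (\<lambda>t. M ((p ^^ t) s) ((p ^^ Suc t) s)) [0..<cyc_len p s])"

definition orbit_of :: "(nat \<Rightarrow> nat) \<Rightarrow> nat \<Rightarrow> nat set" where
  "orbit_of p s = {(p ^^ t) s | t. True}"

definition other_reps :: "nat set \<Rightarrow> (nat \<Rightarrow> nat) \<Rightarrow> nat \<Rightarrow> nat set" where
  "other_reps I p i = {s \<in> I. s \<notin> orbit_of p i \<and> (\<forall>t. s \<le> (p ^^ t) s)}"

definition num_cycles :: "nat set \<Rightarrow> (nat \<Rightarrow> nat) \<Rightarrow> nat \<Rightarrow> nat" where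
  "num_cycles I p i = card (other_reps I p i) + 1"

definition rdet :: "nat set \<Rightarrow> (nat \<Rightarrow> nat \<Rightarrow> quat) \<Rightarrow> nat \<Rightarrow> quat" where
  "rdet I M i = (\<Sum>p\<in>{p. p permutes I}.
     (-1) ^ (card I - num_cycles I p i) *
     (cyc_prod M p i * prod_list (map (cyc_prod M p) (sorted_list_of_set (other_reps I p i)))))"

definition cdet :: "nat set \<Rightarrow> (nat \<Rightarrow> nat \<Rightarrow> quat) \<Rightarrow> nat \<Rightarrow> quat" where
  "cdet I M j = (\<Sum>p\<in>{p. p permutes I}.
     (-1) ^ (card I - num_cycles I p j) *
     (prod_list (map (cyc_prod M p) (rev (sorted_list_of_set (other_reps I p j)))) * cyc_prod M p j))"

text \<open>Determinant of a Hermitian matrix: the common value of all row and column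
  determinants; we take the first row determinant.\<close>
definition hdet :: "nat set \<Rightarrow> (nat \<Rightarrow> nat \<Rightarrow> quat) \<Rightarrow> quat" where
  "hdet I M = rdet I M (Min I)"

definition ddet :: "nat \<Rightarrow> nat \<Rightarrow> (nat \<Rightarrow> nat \<Rightarrow> quat) \<Rightarrow> quat" where
  "ddet m n A = hdet {..<n} (mat_mult m (conj_transpose A) A)"

end

theory Submission
  imports Defs "HOL-Combinatorics.Cycles"
begin

text \<open>
  Splitting off the cycle of \<open>j\<close> turns \<open>cdet\<^sub>j\<close> into a signed sum over paths \<open>j, a\<^sub>1, \<dots>, a\<^sub>l\<close> without
  repetitions, weighted by the minor of the unused indices. For a Hermitian matrix the minors are
  real: reversing a closed path conjugates its product, and the real part is invariant under
  rotation, so the determinant does not depend on the starting index. Splitting off the first step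
  of a path then shows that the path sums form a two-sided adjugate of \<open>M\<close>, with the sole use of
  the fact that the smaller minors are central.

  For \<open>M = A\<^sup>* A\<close> let \<open>e\<^sub>r\<close> be the sum of the principal minors of order \<open>r\<close> and \<open>N\<^sub>r\<close> the vector of
  the numerators of order \<open>r\<close>. The adjugate identity on each \<open>\<beta>\<close> sums to \<open>M N\<^sub>r = e\<^sub>r f - N\<^sub>r\<^sub>+\<^sub>1\<close>.
  As \<open>f = M x\<^sup>0\<close>, every \<open>N\<^sub>r\<close> lies in the range of \<open>M\<close>, which meets the kernel of \<open>M\<close> trivially;
  as \<open>e\<^sub>r = 0\<close> for \<open>r > k\<close>, descending induction gives \<open>N\<^sub>r = 0\<close> for \<open>r > k\<close>. Hence \<open>M N\<^sub>k = e\<^sub>k f\<close> with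
  \<open>N\<^sub>k\<close> orthogonal to the kernel, which characterises \<open>e\<^sub>k x\<^sup>0\<close>.
\<close>

section \<open>Permutations and the cycle through a point\<close>

lemma cyc_len_eq_least_power: "cyc_len p s = least_power p s"
  unfolding cyc_len_def least_power_def by (simp add: conj_commute)

lemma set_support: "permutation p \<Longrightarrow> set (support p s) = orbit_of p s"
  unfolding orbit_of_def by (subst support_set) auto

section \<open>Splitting off the cycle through a point\<close>

definition paths :: "'a set \<Rightarrow> 'a list set" where
  "paths S = {xs. distinct xs \<and> set xs \<subseteq> S}"

lemma finite_paths: "finite S \<Longrightarrow> finite (paths S)"
  unfolding paths_def by (subst conj_commute) (rule finite_subset_distinct)

text \<open>The starting point is kept outside the list, so that the empty list, which encodes a
  fixed point of a permutation, gives the empty product. The factor leading back to the start is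
  supplied separately.\<close>

fun walk_prod :: "(nat \<Rightarrow> nat \<Rightarrow> quat) \<Rightarrow> nat \<Rightarrow> nat list \<Rightarrow> quat" where
  "walk_prod M a [] = 1"
| "walk_prod M a (b # xs) = M a b * walk_prod M b xs"

lemma walk_prod_append:
  "walk_prod M a (xs @ ys) = walk_prod M a xs * walk_prod M (last (a # xs)) ys"
  by (induction xs arbitrary: a) (auto simp: mult.assoc)

lemma prod_list_funpow_eq_walk_prod:
  "prod_list (map (\<lambda>t. M ((p ^^ t) s) ((p ^^ Suc t) s)) [0..<l])
     = walk_prod M s (map (\<lambda>t. (p ^^ Suc t) s) [0..<l])"
proof (induction l)
  case (Suc l)
  have "last (s # map (\<lambda>t. (p ^^ Suc t) s) [0..<l]) = (p ^^ l) s"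
    by (cases l) auto
  then show ?case using Suc by (simp add: walk_prod_append)
qed simp

lemma cyc_prod_eq_walk_prod:
  assumes "support p s = s # xs" "(p ^^ Suc (length xs)) s = s"
  shows "cyc_prod M p s = walk_prod M s xs * M (last (s # xs)) s"
proof -
  let ?l = "length xs"
  have len: "cyc_len p s = Suc ?l"
    using arg_cong[OF assms(1), of length] by (simp add: cyc_len_eq_least_power)
  have sup: "s # xs = map (\<lambda>t. (p ^^ t) s) [0..<Suc ?l]"
    using assms(1) len by (simp add: cyc_len_eq_least_power)
  then have xs: "xs = map (\<lambda>t. (p ^^ Suc t) s) [0..<?l]"
    by (simp del: upt_Suc add: upt_conv_Cons map_Suc_upt[symmetric] comp_def)
  have "cyc_prod M p s = walk_prod M s (map (\<lambda>t. (p ^^ Suc t) s) [0..<Suc ?l])"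
    unfolding cyc_prod_def len by (rule prod_list_funpow_eq_walk_prod)
  also have "map (\<lambda>t. (p ^^ Suc t) s) [0..<Suc ?l] = xs @ [s]"
    using xs assms(2) by simp
  finally show ?thesis by (simp add: walk_prod_append)
qed

text \<open>Together with \<open>drop_orbit\<close> this encodes a permutation as the cycle through
  one point and a permutation of the remaining indices.\<close>

definition join_cycle :: "'a list \<Rightarrow> ('a \<Rightarrow> 'a) \<Rightarrow> 'a \<Rightarrow> 'a" where
  "join_cycle cs q = (\<lambda>x. if x \<in> set cs then cycle_of_list cs x else q x)"

definition drop_orbit :: "(nat \<Rightarrow> nat) \<Rightarrow> nat \<Rightarrow> nat \<Rightarrow> nat" where
  "drop_orbit p s = (\<lambda>x. if x \<in> orbit_of p s then x else p x)"

lemma cycle_of_list_nth: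
  assumes "distinct cs" "i < length cs"
  shows "cycle_of_list cs (cs ! i) = cs ! (Suc i mod length cs)"
proof -
  have "map (cycle_of_list cs) cs = rotate1 cs"
    using cyclic_rotation[OF assms(1), of 1] by simp
  then show ?thesis using assms(2) by (metis nth_map nth_rotate1)
qed

lemma funpow_join_cycle_hd:
  assumes "distinct (s # xs)"
  shows "(join_cycle (s # xs) q ^^ t) s = (s # xs) ! (t mod length (s # xs))"
proof (induction t)
  case (Suc t)
  let ?cs = "s # xs"
  have lt: "t mod length ?cs < length ?cs" by simp
  have "(join_cycle ?cs q ^^ Suc t) s = join_cycle ?cs q (?cs ! (t mod length ?cs))"
    using Suc by simp
  also have "\<dots> = cycle_of_list ?cs (?cs ! (t mod length ?cs))"
    unfolding join_cycle_def using nth_mem[OF lt] by simp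
  also have "\<dots> = ?cs ! (Suc (t mod length ?cs) mod length ?cs)"
    using cycle_of_list_nth[OF assms lt] .
  finally show ?case by (simp add: mod_Suc_eq)
qed simp

lemma support_join_cycle:
  assumes "distinct (s # xs)"
  shows "support (join_cycle (s # xs) q) s = s # xs"
    and "(join_cycle (s # xs) q ^^ Suc (length xs)) s = s"
proof -
  let ?cs = "s # xs" and ?p = "join_cycle (s # xs) q"
  note pow = funpow_join_cycle_hd[OF assms, where q = q]
  show ret: "(?p ^^ Suc (length xs)) s = s" using pow[of "Suc (length xs)"] by simp
  have lp: "least_power ?p s = length ?cs"
    unfolding least_power_def
  proof (rule Least_equality)
    show "(?p ^^ length ?cs) s = s \<and> 0 < length ?cs" using ret by simp
    fix t assume t: "(?p ^^ t) s = s \<and> 0 < t"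
    show "length ?cs \<le> t"
    proof (rule ccontr)
      assume n: "\<not> length ?cs \<le> t"
      then have "?cs ! t = ?cs ! 0" using t pow[of t] by simp
      then have "t = 0" using assms n nth_eq_iff_index_eq[OF assms, of t 0] by simp
      then show False using t by simp
    qed
  qed
  have "support ?p s = map (\<lambda>t. ?cs ! t) [0..<length ?cs]"
    unfolding lp by (rule map_cong) (use pow in auto)
  then show "support ?p s = ?cs" by (simp only: map_nth)
qed

lemma join_cycle_permutes:
  assumes "distinct cs" "set cs \<subseteq> I" "q permutes (I - set cs)"
  shows "join_cycle cs q permutes I"
proof -
  have q: "q x \<notin> set cs \<longleftrightarrow> x \<notin> set cs" for x
    using permutes_in_image[OF assms(3)] permutes_not_in[OF assms(3)] by (metis DiffD2 DiffI)
  have "join_cycle cs q = cycle_of_list cs \<circ> q"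
    using assms(3) q
    by (auto simp: join_cycle_def fun_eq_iff id_outside_supp permutes_not_in)
  moreover have "cycle_of_list cs permutes I"
    using cycle_permutes permutes_subset assms(2) by blast
  moreover have "q permutes I"
    using assms(3) permutes_subset by blast
  ultimately show ?thesis by (simp add: permutes_compose)
qed

lemma drop_orbit_permutes:
  assumes "finite I" "p permutes I"
  shows "drop_orbit p s permutes (I - orbit_of p s)"
proof -
  have perm: "permutation p" using assms permutation_permutes by blast
  have inj: "inj p" using assms(2) permutes_inj by blast
  have step: "p x \<in> orbit_of p s \<longleftrightarrow> x \<in> orbit_of p s" for x
  proof
    assume "p x \<in> orbit_of p s"
    then obtain t where t: "p x = (p ^^ t) s" unfolding orbit_of_def by auto
    \<comment> \<open>The exponent \<open>t\<close> may be 0; adding a full period makes it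
      positive, so that one application of \<open>p\<close> can be cancelled.\<close>
    let ?L = "least_power p s"
    have L: "(p ^^ ?L) s = s" "0 < ?L" using least_power_of_permutation[OF perm] by auto
    have "p x = (p ^^ (t + ?L)) s" using t L by (simp add: funpow_add)
    also have "\<dots> = p ((p ^^ (t + ?L - 1)) s)"
      using L(2) by (metis Suc_diff_1 add_gr_0 comp_apply funpow.simps(2))
    finally have "x = (p ^^ (t + ?L - 1)) s" using inj by (simp add: inj_eq)
    then show "x \<in> orbit_of p s" unfolding orbit_of_def by auto
  next
    assume "x \<in> orbit_of p s"
    then obtain t where "x = (p ^^ t) s" unfolding orbit_of_def by auto
    then have "p x = (p ^^ Suc t) s" by simp
    then show "p x \<in> orbit_of p s" unfolding orbit_of_def by blast
  qed
  have "inj (drop_orbit p s)"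
  proof (rule injI)
    fix x y assume "drop_orbit p s x = drop_orbit p s y"
    then show "x = y" using step[of x] step[of y] inj
      by (auto simp: drop_orbit_def inj_eq split: if_splits)
  qed
  moreover have "drop_orbit p s x = x" if "x \<notin> I - orbit_of p s" for x
    using that assms(2) by (auto simp: drop_orbit_def permutes_not_in)
  moreover have "drop_orbit p s ` (I - orbit_of p s) \<subseteq> I - orbit_of p s"
    using step permutes_in_image[OF assms(2)] by (auto simp: drop_orbit_def)
  ultimately show ?thesis
    using assms(1) by (metis finite_Diff inj_imp_permutes image_subset_iff inj_on_subset subset_UNIV)
qed

text \<open>The bijection sends \<open>p\<close> to its cycle through \<open>s\<close>, with
  \<open>s\<close> itself dropped, and to \<open>drop_orbit p s\<close>; the inverse is
  \<open>join_cycle\<close>. The expansions of \<open>cdet\<close> and \<open>rdet\<close> start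
  from it.\<close>

lemma sum_permutes_split_cycle:
  fixes I :: "nat set"
  assumes "finite I" "s \<in> I"
  shows "(\<Sum>p | p permutes I. G p) =
    (\<Sum>xs\<in>paths (I - {s}). \<Sum>q | q permutes (I - {s} - set xs). G (join_cycle (s # xs) q))"
proof -
  let ?T = "Sigma (paths (I - {s})) (\<lambda>xs. {q. q permutes (I - {s} - set xs)})"
  have T: "distinct (s # xs)" "set (s # xs) \<subseteq> I" "q permutes (I - set (s # xs))"
    if "(xs, q) \<in> ?T" for xs q
  proof -
    show "distinct (s # xs)" "set (s # xs) \<subseteq> I" using that assms(2) by (auto simp: paths_def)
    have "I - set (s # xs) = I - {s} - set xs" by auto
    then show "q permutes (I - set (s # xs))" using that by auto
  qed
  have "(\<Sum>p | p permutes I. G p) = (\<Sum>(xs, q)\<in>?T. G (join_cycle (s # xs) q))"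
  proof (rule sum.reindex_bij_witness[where
        j = "\<lambda>p. (tl (support p s), drop_orbit p s)" and i = "\<lambda>(xs, q). join_cycle (s # xs) q"])
    fix p assume "p \<in> {p. p permutes I}"
    then have p: "p permutes I" by simp
    have perm: "permutation p" using assms p permutation_permutes by blast
    let ?L = "least_power p s"
    have L: "(p ^^ ?L) s = s" "0 < ?L" using least_power_of_permutation[OF perm] by auto
    have sup: "support p s = s # tl (support p s)"
      using L(2) by (simp add: upt_conv_Cons)
    have d: "distinct (support p s)" by (rule cycle_of_permutation[OF perm])
    have orb: "set (support p s) = orbit_of p s" by (rule set_support[OF perm])
    have sub: "orbit_of p s \<subseteq> I"
      unfolding orbit_of_def using permutes_in_image[OF permutes_funpow[OF p]] assms(2) by auto
    have "join_cycle (support p s) (drop_orbit p s) x = p x" for x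
    proof (cases "x \<in> orbit_of p s")
      case True
      then obtain i where i: "i < length (support p s)" "x = support p s ! i"
        using orb by (metis in_set_conv_nth)
      then have "join_cycle (support p s) (drop_orbit p s) x
          = support p s ! (Suc i mod length (support p s))"
        using cycle_of_list_nth[OF d i(1)] True orb by (simp only: join_cycle_def if_True)
      also have "\<dots> = (p ^^ (Suc i mod ?L)) s" using L(2) by simp
      also have "\<dots> = p ((p ^^ i) s)"
        using L i(1) by (cases "Suc i = ?L") (auto simp: mod_Suc, metis comp_apply funpow.simps(2))
      finally show ?thesis using i by simp
    next
      case False
      then show ?thesis by (simp only: join_cycle_def orb drop_orbit_def if_False)
    qed
    then show J: "(case (tl (support p s), drop_orbit p s) of (xs, q) \<Rightarrow> join_cycle (s # xs) q) = p"
      using sup by auto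
    have "set (tl (support p s)) = orbit_of p s - {s}" "s \<in> orbit_of p s"
      using d orb sup by (metis Diff_insert_absorb distinct.simps(2) list.simps(15),
          metis list.set_intros(1))
    then have "I - {s} - set (tl (support p s)) = I - orbit_of p s" by auto
    then show "(tl (support p s), drop_orbit p s) \<in> ?T"
      using d sub \<open>set (tl (support p s)) = orbit_of p s - {s}\<close> drop_orbit_permutes[OF assms(1) p]
        distinct_tl[OF d]
      by (auto simp: paths_def)
    show "(case (tl (support p s), drop_orbit p s) of (xs, q) \<Rightarrow> G (join_cycle (s # xs) q)) = G p"
      using J by simp
  next
    fix b assume b: "b \<in> ?T"
    obtain xs q where [simp]: "b = (xs, q)" by (cases b)
    note t = T[OF b[simplified \<open>b = (xs, q)\<close>]]
    let ?p = "join_cycle (s # xs) q"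
    have p: "?p permutes I" using join_cycle_permutes[OF t] .
    then show "(case b of (xs, q) \<Rightarrow> join_cycle (s # xs) q) \<in> {p. p permutes I}" by simp
    have perm: "permutation ?p" using assms p permutation_permutes by blast
    have sup: "support ?p s = s # xs" using support_join_cycle(1)[OF t(1)] .
    have orb: "orbit_of ?p s = set (s # xs)" using set_support[OF perm, of s] sup by simp
    have "drop_orbit ?p s = q"
      unfolding drop_orbit_def orb using t(3) by (auto simp: join_cycle_def permutes_not_in)
    then show "(tl (support (case b of (xs, q) \<Rightarrow> join_cycle (s # xs) q) s),
        drop_orbit (case b of (xs, q) \<Rightarrow> join_cycle (s # xs) q) s) = b"
      using sup by simp
  qed
  also have "\<dots> = (\<Sum>xs\<in>paths (I - {s}). \<Sum>q | q permutes (I - {s} - set xs). G (join_cycle (s # xs) q))"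
    using assms(1) by (intro sum.Sigma[symmetric]) (auto simp: finite_paths finite_permutations)
  finally show ?thesis .
qed

section \<open>Determinants with every cycle listed by its minimum\<close>

definition cycle_reps :: "nat set \<Rightarrow> (nat \<Rightarrow> nat) \<Rightarrow> nat set" where
  "cycle_reps I p = {s \<in> I. \<forall>t. s \<le> (p ^^ t) s}"

text \<open>On the complement of the split-off cycle all powers of \<open>p\<close> and
  \<open>q\<close> agree, so cycle lengths, cycle products and minima of cycles are those of
  \<open>q\<close>.\<close>

lemma join_cycle_outside:
  assumes "distinct (s # xs)" "set (s # xs) \<subseteq> I" "finite I" "q permutes (I - set (s # xs))"
  defines "p \<equiv> join_cycle (s # xs) q"
  shows "cyc_prod N p s = walk_prod N s xs * N (last (s # xs)) s"
    and "other_reps I p s = cycle_reps (I - set (s # xs)) q"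
    and "\<And>r. r \<in> I - set (s # xs) \<Longrightarrow> cyc_prod N p r = cyc_prod N q r"
proof -
  have p: "p permutes I" unfolding p_def using join_cycle_permutes assms by blast
  have perm: "permutation p" using assms(3) p permutation_permutes by blast
  show "cyc_prod N p s = walk_prod N s xs * N (last (s # xs)) s"
    unfolding p_def by (rule cyc_prod_eq_walk_prod) (use support_join_cycle[OF assms(1)] in auto)
  have orb: "orbit_of p s = set (s # xs)"
    using set_support[OF perm, of s] support_join_cycle(1)[OF assms(1), of q] unfolding p_def by simp
  have pow: "(p ^^ t) r = (q ^^ t) r \<and> (q ^^ t) r \<in> I - set (s # xs)"
    if "r \<in> I - set (s # xs)" for r t
  proof (induction t)
    case (Suc t)
    then show ?case
      using permutes_in_image[OF assms(4), of "(q ^^ t) r"] by (auto simp: p_def join_cycle_def)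
  qed (use that in simp)
  show "other_reps I p s = cycle_reps (I - set (s # xs)) q"
    unfolding other_reps_def cycle_reps_def orb using pow by auto
  fix r assume r: "r \<in> I - set (s # xs)"
  have e: "(p ^^ t) r = (q ^^ t) r" for t using pow[OF r] by blast
  show "cyc_prod N p r = cyc_prod N q r"
    unfolding cyc_prod_def cyc_len_def e ..
qed

text \<open>\<open>Min I\<close> is the smallest element of its own cycle and thus the only
  representative in it. Hence a determinant started at \<open>Min I\<close> lists every cycle by its
  minimum.\<close>

lemma cycle_reps_eq_insert_Min:
  assumes "finite I" "I \<noteq> {}" "p permutes I"
  shows "cycle_reps I p = insert (Min I) (other_reps I p (Min I))"
    and "\<forall>s\<in>other_reps I p (Min I). Min I < s"
proof -
  have perm: "permutation p" using assms permutation_permutes by blast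
  have M: "Min I \<in> I" using assms by simp
  have le: "Min I \<le> (p ^^ t) s" if "s \<in> I" for s t
    using permutes_in_image[OF permutes_funpow[OF assms(3), of t], of s] that assms(1) by simp
  have eq: "s = Min I" if s: "s \<in> cycle_reps I p" "s \<in> orbit_of p (Min I)" for s
  proof -
    have "s \<in> set (support p (Min I))" using s(2) set_support[OF perm] by simp
    then have "set (support p s) \<inter> set (support p (Min I)) \<noteq> {}"
      using disjoint_support'[OF perm] by blast
    then have "Min I \<in> set (support p s)" using disjoint_support'[OF perm] by blast
    then have "Min I \<in> orbit_of p s" using set_support[OF perm, of s] by simp
    then obtain t where "Min I = (p ^^ t) s" unfolding orbit_of_def by auto
    then have "s \<le> Min I" using s(1) unfolding cycle_reps_def by auto
    moreover have "Min I \<le> s" using s(1) assms(1) unfolding cycle_reps_def by auto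
    ultimately show ?thesis by simp
  qed
  have self: "s \<in> orbit_of p s" for s
    unfolding orbit_of_def by (auto intro: exI[of _ 0])
  show "cycle_reps I p = insert (Min I) (other_reps I p (Min I))"
    using eq le M by (auto simp: cycle_reps_def other_reps_def)
  show "\<forall>s\<in>other_reps I p (Min I). Min I < s"
    using self assms(1) by (auto simp: other_reps_def intro!: le_neq_trans)
qed

text \<open>The value 1 at the empty set replaces the junk value of \<open>cdet\<close> and \<open>hdet\<close> there.\<close>

definition pdet :: "(nat \<Rightarrow> nat \<Rightarrow> quat) \<Rightarrow> nat set \<Rightarrow> quat" where
  "pdet M S = (if S = {} then 1 else cdet S M (Min S))"

definition prdet :: "(nat \<Rightarrow> nat \<Rightarrow> quat) \<Rightarrow> nat set \<Rightarrow> quat" where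
  "prdet M S = (if S = {} then 1 else hdet S M)"

lemma sorted_list_of_set_cycle_reps:
  assumes "finite I" "I \<noteq> {}" "p permutes I"
  shows "sorted_list_of_set (cycle_reps I p) = Min I # sorted_list_of_set (other_reps I p (Min I))"
    and "card (cycle_reps I p) = num_cycles I p (Min I)"
proof -
  have fin: "finite (other_reps I p (Min I))" unfolding other_reps_def using assms(1) by simp
  note c = cycle_reps_eq_insert_Min[OF assms]
  have nin: "Min I \<notin> other_reps I p (Min I)" using c(2) by auto
  show "card (cycle_reps I p) = num_cycles I p (Min I)"
    unfolding c(1) num_cycles_def using fin nin by simp
  show "sorted_list_of_set (cycle_reps I p) = Min I # sorted_list_of_set (other_reps I p (Min I))"
    unfolding c(1) using fin nin c(2)
    by (simp add: insort_is_Cons less_imp_le)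
qed

text \<open>\<open>Min I\<close> heads the sorted representatives, so its cycle product stands first
  for \<open>hdet\<close> and, after reversal, last for \<open>cdet\<close>. These formulas single
  out no index, which is the form in which the complement of a split-off cycle appears.\<close>

lemma pdet_cycle_reps:
  assumes "finite I"
  shows "pdet N I = (\<Sum>p | p permutes I. (-1) ^ (card I - card (cycle_reps I p)) *
           prod_list (map (cyc_prod N p) (rev (sorted_list_of_set (cycle_reps I p)))))"
    and "prdet N I = (\<Sum>p | p permutes I. (-1) ^ (card I - card (cycle_reps I p)) *
           prod_list (map (cyc_prod N p) (sorted_list_of_set (cycle_reps I p))))"
proof -
  consider "I = {}" | "I \<noteq> {}" by blast
  then have "pdet N I = (\<Sum>p | p permutes I. (-1) ^ (card I - card (cycle_reps I p)) *
           prod_list (map (cyc_prod N p) (rev (sorted_list_of_set (cycle_reps I p))))) \<and>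
     prdet N I = (\<Sum>p | p permutes I. (-1) ^ (card I - card (cycle_reps I p)) *
           prod_list (map (cyc_prod N p) (sorted_list_of_set (cycle_reps I p))))"
  proof cases
    case 1
    have "{p. p permutes ({} :: nat set)} = {id}" by auto
    then show ?thesis using 1 by (simp add: pdet_def prdet_def cycle_reps_def)
  next
    case 2
    then show ?thesis
      using assms unfolding pdet_def prdet_def hdet_def cdet_def rdet_def
      by (auto intro!: sum.cong simp: sorted_list_of_set_cycle_reps)
  qed
  then show "pdet N I = (\<Sum>p | p permutes I. (-1) ^ (card I - card (cycle_reps I p)) *
           prod_list (map (cyc_prod N p) (rev (sorted_list_of_set (cycle_reps I p)))))"
    and "prdet N I = (\<Sum>p | p permutes I. (-1) ^ (card I - card (cycle_reps I p)) *
           prod_list (map (cyc_prod N p) (sorted_list_of_set (cycle_reps I p))))"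
    by auto
qed

text \<open>The function \<open>g\<close> stands for the column that closes the cycle: with
  \<open>S = I - {j}\<close> and start \<open>j\<close>, taking column \<open>j\<close> for
  \<open>g\<close> gives \<open>cdet\<close>, and any other \<open>g\<close> gives
  \<open>cdet\<close> with that column replaced. The minor stands on the left, where
  \<open>cdet\<close> puts the other cycles.\<close>

definition path_sum :: "(nat \<Rightarrow> nat \<Rightarrow> quat) \<Rightarrow> nat set \<Rightarrow> nat \<Rightarrow> (nat \<Rightarrow> quat) \<Rightarrow> quat" where
  "path_sum M S a g = (\<Sum>xs\<in>paths S. (-1) ^ length xs *
     (pdet M (S - set xs) * (walk_prod M a xs * g (last (a # xs)))))"

lemma sign_commute: "(-1) ^ k * (a :: 'a :: ring_1) = a * (-1) ^ k"
  by (cases "even k") auto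

text \<open>A cycle on \<open>length xs + 1\<close> points contributes \<open>length xs\<close> to
  the exponent of the sign.\<close>

lemma det_join_cycle_term:
  assumes "finite I" "s \<in> I" "xs \<in> paths (I - {s})" "q permutes (I - {s} - set xs)"
  defines "R \<equiv> I - {s} - set xs"
  defines "p \<equiv> join_cycle (s # xs) q"
  shows "card I - num_cycles I p s = length xs + (card R - card (cycle_reps R q))"
    and "other_reps I p s = cycle_reps R q"
    and "cyc_prod N p s = walk_prod N s xs * N (last (s # xs)) s"
    and "map (cyc_prod N p) (sorted_list_of_set (cycle_reps R q))
       = map (cyc_prod N q) (sorted_list_of_set (cycle_reps R q))"
    and "map (cyc_prod N p) (rev (sorted_list_of_set (cycle_reps R q)))
       = map (cyc_prod N q) (rev (sorted_list_of_set (cycle_reps R q)))"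
proof -
  have t: "distinct (s # xs)" "set (s # xs) \<subseteq> I" using assms(2,3) by (auto simp: paths_def)
  have R: "R = I - set (s # xs)" by (auto simp: R_def)
  note j = join_cycle_outside[OF t assms(1), of q, folded p_def R, OF assms(4)[folded R_def]]
  show "other_reps I p s = cycle_reps R q" by (rule j)
  have fin: "finite R" "finite (cycle_reps R q)" "cycle_reps R q \<subseteq> R"
    using assms(1) by (auto simp: R cycle_reps_def)
  have "card I = card (set (s # xs)) + card R"
    using t(2) assms(1) unfolding R
    by (metis List.finite_set add.commute card_Diff_subset card_mono le_add_diff_inverse2)
  then have "card I = Suc (length xs) + card R" using t(1) distinct_card by fastforce
  \<comment> \<open>The exponents use truncated subtraction; this bound makes them add up.\<close>
  moreover have "card (cycle_reps R q) \<le> card R" using fin by (simp add: card_mono)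
  ultimately show "card I - num_cycles I p s = length xs + (card R - card (cycle_reps R q))"
    unfolding num_cycles_def j(2) by simp
  show "cyc_prod N p s = walk_prod N s xs * N (last (s # xs)) s" by (rule j)
  show "map (cyc_prod N p) (sorted_list_of_set (cycle_reps R q))
       = map (cyc_prod N q) (sorted_list_of_set (cycle_reps R q))"
    "map (cyc_prod N p) (rev (sorted_list_of_set (cycle_reps R q)))
       = map (cyc_prod N q) (rev (sorted_list_of_set (cycle_reps R q)))"
    using fin j(3) by auto
qed

lemma cdet_eq_path_sum:
  assumes "finite I" "s \<in> I"
  shows "cdet I N s = path_sum N (I - {s}) s (\<lambda>a. N a s)"
  unfolding cdet_def path_sum_def sum_permutes_split_cycle[OF assms]
proof (rule sum.cong[OF refl], goal_cases)
  case (1 xs)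
  show ?case
    unfolding pdet_cycle_reps(1)[OF finite_Diff[OF finite_Diff[OF assms(1)]]]
      sum_distrib_right sum_distrib_left
  proof (rule sum.cong[OF refl], goal_cases)
    case (1 q)
    with \<open>xs \<in> paths (I - {s})\<close> show ?case
      using det_join_cycle_term[OF assms \<open>xs \<in> paths (I - {s})\<close>, of q]
      by (simp only: power_add mem_Collect_eq) (simp only: mult.assoc)
  qed
qed

lemma rdet_eq_path_sum:
  assumes "finite I" "s \<in> I"
  shows "rdet I N s = (\<Sum>xs\<in>paths (I - {s}). (-1) ^ length xs *
     (walk_prod N s xs * N (last (s # xs)) s * prdet N (I - {s} - set xs)))"
  unfolding rdet_def sum_permutes_split_cycle[OF assms]
proof (rule sum.cong[OF refl], goal_cases)
  case (1 xs)
  let ?R = "I - {s} - set xs"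
  show ?case
    unfolding pdet_cycle_reps(2)[OF finite_Diff[OF finite_Diff[OF assms(1)]]]
      sum_distrib_right sum_distrib_left
  proof (rule sum.cong[OF refl], goal_cases)
    case (1 q)
    let ?e = "(-1) ^ (card ?R - card (cycle_reps ?R q)) :: quat"
    let ?w = "walk_prod N s xs * N (last (s # xs)) s"
    have c: "?w * (?e * z) = ?e * (?w * z)" for z
      by (metis mult.assoc sign_commute)
    from 1 \<open>xs \<in> paths (I - {s})\<close> show ?case
      using det_join_cycle_term[OF assms \<open>xs \<in> paths (I - {s})\<close>, of q]
      by (simp only: power_add mem_Collect_eq c) (simp only: mult.assoc)
  qed
qed

section \<open>Conjugation of quaternions\<close>

lemmas quat_ops = zero_quat_def one_quat_def plus_quat_def minus_quat_def uminus_quat_def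
  times_quat_def qcnj_def

lemma qcnj_qcnj [simp]: "qcnj (qcnj a) = a"
  and qcnj_0 [simp]: "qcnj 0 = 0"
  and qcnj_1 [simp]: "qcnj 1 = 1"
  and qcnj_minus [simp]: "qcnj (- a) = - qcnj a"
  and qcnj_add: "qcnj (a + b) = qcnj a + qcnj b"
  and qcnj_mult: "qcnj (a * b) = qcnj b * qcnj a"
  by (simp_all add: quat_ops algebra_simps)

lemma qcnj_sum: "qcnj (sum g S) = (\<Sum>i\<in>S. qcnj (g i))"
  by (induction S rule: infinite_finite_induct) (simp_all add: qcnj_add)

lemma qcnj_sign [simp]: "qcnj ((-1) ^ k) = (-1) ^ k"
  by (cases "even k") auto

lemma qre_0 [simp]: "qre 0 = 0"
  and qre_1 [simp]: "qre 1 = 1"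
  and qre_minus [simp]: "qre (- a) = - qre a"
  and qre_add: "qre (a + b) = qre a + qre b"
  by (simp_all add: quat_ops)

lemma qre_sum: "qre (sum g S) = (\<Sum>i\<in>S. qre (g i))"
  by (induction S rule: infinite_finite_induct) (simp_all add: qre_add)

text \<open>Cyclicity of the real part lets a closed walk start at another of its points.\<close>

lemma qre_mult_commute: "qre (a * b) = qre (b * a)"
  by (simp add: quat_ops)

lemma qre_sign_mult: "qre ((-1) ^ k * a) = (-1) ^ k * qre a"
  by (cases "even k") auto

text \<open>Being real is expressed throughout as being fixed by \<open>qcnj\<close>; the next
  lemmas draw from it that such quaternions are central and determined by their real part.\<close>

lemma qcnj_eq_self_iff: "qcnj a = a \<longleftrightarrow> a = Quat (qre a) 0 0 0"
  by (cases a) (auto simp: qcnj_def)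

lemma self_conj_commute: "qcnj a = a \<Longrightarrow> a * b = b * a"
  by (subst (asm) qcnj_eq_self_iff, erule ssubst) (simp add: quat_ops)

lemma self_conj_left_commute: "qcnj a = a \<Longrightarrow> b * (a * c) = a * (b * c)"
  by (metis mult.assoc self_conj_commute)

lemma qre_self_conj_mult: "qcnj a = a \<Longrightarrow> qre (a * b) = qre a * qre b"
  by (subst (asm) qcnj_eq_self_iff, erule ssubst) (simp add: quat_ops)

lemma self_conj_eqI: "qcnj a = a \<Longrightarrow> qcnj b = b \<Longrightarrow> qre a = qre b \<Longrightarrow> a = b"
  by (metis qcnj_eq_self_iff)

lemma self_conj_mult_eq_0: "qcnj a = a \<Longrightarrow> a * b = 0 \<Longrightarrow> b \<noteq> 0 \<Longrightarrow> a = 0"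
  by (cases a, cases b) (auto simp: quat_ops)

lemma qre_qcnj_mult_self: "qre (qcnj a * a) = qnormsq a"
  by (simp add: quat_ops qnormsq_def power2_eq_square)

lemma qnormsq_nonneg [simp]: "0 \<le> qnormsq a"
  by (simp add: qnormsq_def)

lemma qnormsq_eq_0_iff [simp]: "qnormsq a = 0 \<longleftrightarrow> a = 0"
proof
  assume "qnormsq a = 0"
  then have "(qre a)\<^sup>2 = 0 \<and> (qi a)\<^sup>2 = 0 \<and> (qj a)\<^sup>2 = 0 \<and> (qk a)\<^sup>2 = 0"
    unfolding qnormsq_def
    by (smt (verit) zero_le_power2)
  then show "a = 0" by (cases a) (simp add: quat_ops)
qed (simp add: qnormsq_def quat_ops)

text \<open>Expansion along a real line. A free \<open>s\<close> serves the variation of a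
  minimizer, \<open>s = 1\<close> the comparison of two norms.\<close>

lemma qnormsq_diff_real_multiple:
  "qnormsq (a - b * Quat s 0 0 0) = qnormsq a - 2 * s * qre (qcnj a * b) + s\<^sup>2 * qnormsq b"
  by (simp add: quat_ops qnormsq_def power2_eq_square algebra_simps)

lemma qinv_self_conj:
  assumes "qcnj a = a" "qre a \<noteq> 0"
  shows "a * qinv a = 1"
proof -
  have a: "a = Quat (qre a) 0 0 0" using assms(1) qcnj_eq_self_iff by blast
  have "Quat r 0 0 0 * qinv (Quat r 0 0 0) = 1" if "r \<noteq> 0" for r
    using that by (simp add: qinv_def qnormsq_def quat_ops power2_eq_square)
  then show ?thesis using a assms(2) by metis
qed

section \<open>Path expansions for Hermitian matrices\<close>

text \<open>Demanded at all natural numbers instead of an index range, so that every index subset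
  inherits it. Gram matrices satisfy this, as one formula defines all their entries.\<close>

definition hermitian :: "(nat \<Rightarrow> nat \<Rightarrow> quat) \<Rightarrow> bool" where
  "hermitian M \<longleftrightarrow> (\<forall>i j. qcnj (M i j) = M j i)"

text \<open>Conjugation reverses the factors and swaps the indices of each Hermitian entry, so the
  walk is traversed backwards.\<close>

lemma qcnj_walk_prod:
  assumes "hermitian M"
  shows "qcnj (walk_prod M a (xs @ [b])) = walk_prod M b (rev xs @ [a])"
proof (induction xs arbitrary: a)
  case Nil
  then show ?case using assms by (simp add: hermitian_def)
next
  case (Cons c xs)
  have "qcnj (walk_prod M a ((c # xs) @ [b])) = walk_prod M b (rev xs @ [c]) * M c a"
    using Cons assms by (simp add: qcnj_mult hermitian_def)
  then show ?case by (simp add: walk_prod_append mult.assoc)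
qed

lemma rev_in_paths [simp]: "rev xs \<in> paths S \<longleftrightarrow> xs \<in> paths S"
  by (simp add: paths_def)

lemma sum_paths_rev: "(\<Sum>xs\<in>paths S. G (rev xs)) = (\<Sum>xs\<in>paths S. G xs)"
  by (rule sum.reindex_bij_witness[of _ rev rev]) auto

lemma sum_paths_Cons:
  assumes "finite S"
  shows "(\<Sum>xs\<in>paths S. G xs) = G [] + (\<Sum>b\<in>S. \<Sum>ys\<in>paths (S - {b}). G (b # ys))"
proof -
  let ?T = "Sigma S (\<lambda>b. paths (S - {b}))"
  have eq: "paths S = insert [] ((\<lambda>(b, ys). b # ys) ` ?T)"
  proof (intro set_eqI iffI)
    fix xs assume "xs \<in> paths S"
    then show "xs \<in> insert [] ((\<lambda>(b, ys). b # ys) ` ?T)"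
      by (cases xs) (auto simp: paths_def intro!: image_eqI)
  qed (auto simp: paths_def)
  have fin: "finite ?T" using assms by (auto intro: finite_paths)
  have inj: "inj_on (\<lambda>(b, ys). b # ys) ?T" by (auto simp: inj_on_def)
  have "(\<Sum>xs\<in>paths S. G xs) = G [] + (\<Sum>xs\<in>(\<lambda>(b, ys). b # ys) ` ?T. G xs)"
    unfolding eq using fin by (subst sum.insert) auto
  also have "(\<Sum>xs\<in>(\<lambda>(b, ys). b # ys) ` ?T. G xs) = (\<Sum>(b, ys)\<in>?T. G (b # ys))"
    by (subst sum.reindex[OF inj]) (auto intro!: sum.cong)
  also have "\<dots> = (\<Sum>b\<in>S. \<Sum>ys\<in>paths (S - {b}). G (b # ys))"
    using assms by (intro sum.Sigma[symmetric]) (auto intro: finite_paths)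
  finally show ?thesis .
qed

text \<open>A path without repetitions meets \<open>t\<close> once and is cut there; requiring
  \<open>ys @ zs\<close> to be a path keeps the two pieces disjoint.\<close>

lemma sum_paths_through:
  assumes "finite S" "t \<in> S"
  shows "(\<Sum>xs\<in>{xs \<in> paths S. t \<in> set xs}. G xs)
       = (\<Sum>(ys, zs)\<in>{(ys, zs). ys @ zs \<in> paths (S - {t})}. G (ys @ t # zs))"
proof -
  let ?P = "{(ys, zs). ys @ zs \<in> paths (S - {t})}"
  have eq: "{xs \<in> paths S. t \<in> set xs} = (\<lambda>(ys, zs). ys @ t # zs) ` ?P"
  proof (intro set_eqI iffI)
    fix xs assume "xs \<in> {xs \<in> paths S. t \<in> set xs}"
    moreover then obtain ys zs where "xs = ys @ t # zs" by (auto dest: split_list)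
    ultimately show "xs \<in> (\<lambda>(ys, zs). ys @ t # zs) ` ?P"
      by (auto simp: paths_def intro!: image_eqI[of _ _ "(ys, zs)"])
  qed (use assms in \<open>auto simp: paths_def\<close>)
  have "inj_on (\<lambda>(ys, zs). ys @ t # zs) ?P"
  proof (rule inj_onI, clarify)
    fix ys zs ys' zs'
    assume "ys @ zs \<in> paths (S - {t})" "ys' @ zs' \<in> paths (S - {t})" "ys @ t # zs = ys' @ t # zs'"
    moreover then have "t \<notin> set ys" "t \<notin> set zs" by (auto simp: paths_def)
    ultimately show "ys = ys' \<and> zs = zs'" by (simp add: append_Cons_eq_iff)
  qed
  then show ?thesis unfolding eq by (subst sum.reindex) (auto intro!: sum.cong)
qed

lemma closed_path_sum_eq:
  "path_sum M (S - {s}) s (\<lambda>a. M a s) =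
     (\<Sum>xs\<in>paths (S - {s}). (-1) ^ length xs * (pdet M (S - {s} - set xs) * walk_prod M s (xs @ [s])))"
  unfolding path_sum_def by (simp only: walk_prod_append walk_prod.simps mult_1_right)

text \<open>Both claims go through one induction, since each uses that the smaller minors are real
  or can be expanded at any of their indices. Reversing paths shows that the expansion at
  \<open>s\<close> is real; it remains to compare the real parts of the expansions at
  \<open>s\<close> and \<open>t\<close>, inside which closed walks may be rotated.\<close>

lemma pdet_hermitian:
  assumes "hermitian M" "finite S"
  shows "qcnj (pdet M S) = pdet M S \<and> (\<forall>s\<in>S. path_sum M (S - {s}) s (\<lambda>a. M a s) = pdet M S)"
  using assms(2)
proof (induction S rule: finite_psubset_induct)
  case (psubset S)
  let ?E = "\<lambda>B s. path_sum M (B - {s}) s (\<lambda>a. M a s)"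
  define d where "d B = qre (pdet M B)" for B
  define w where "w s xs = (-1) ^ length xs * qre (walk_prod M s (xs @ [s]))" for s xs
  have sub: "S - {s} - set xs \<subset> S" if "s \<in> S" for s xs using that by auto
  have real: "qcnj (pdet M B) = pdet M B" if "B \<subset> S" for B using psubset.IH[OF that] by blast
  have E_real: "qcnj (?E S s) = ?E S s" if s: "s \<in> S" for s
  proof -
    have "qcnj (?E S s) = (\<Sum>xs\<in>paths (S - {s}). (-1) ^ length (rev xs) *
        (pdet M (S - {s} - set (rev xs)) * walk_prod M s (rev xs @ [s])))"
      unfolding closed_path_sum_eq qcnj_sum
      using real[OF sub[OF s]]
      by (intro sum.cong refl)
        (simp add: qcnj_mult qcnj_walk_prod[OF assms(1)] self_conj_commute sign_commute[symmetric])
    also have "\<dots> = ?E S s" unfolding closed_path_sum_eq by (rule sum_paths_rev)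
    finally show ?thesis .
  qed
  have qre_E: "qre (?E B s) = (\<Sum>xs\<in>paths (B - {s}). w s xs * d (B - {s} - set xs))"
    if "s \<in> B" "B \<subseteq> S" for B s
  proof -
    have "B - {s} - set xs \<subset> S" for xs using that by auto
    then show ?thesis
      unfolding closed_path_sum_eq qre_sum w_def d_def
      by (intro sum.cong refl) (simp add: qre_sign_mult qre_self_conj_mult[OF real])
  qed
  have indep: "?E S s = ?E S t" if st: "s \<in> S" "t \<in> S" for s t
  proof (cases "s = t")
    case False
    define R where "R = S - {s, t}"
    have finR: "finite R" using psubset.hyps by (simp add: R_def)
    \<comment> \<open>Closed paths from \<open>s\<close> that avoid \<open>t\<close> leave
      \<open>t\<close> in the minor, which is expanded at \<open>t\<close>; this gives pairs of
      disjoint closed paths. The paths through \<open>t\<close> are cut there. Both sums turn out to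
      be symmetric in \<open>s\<close> and \<open>t\<close>.\<close>
    have split: "qre (?E S s) =
        (\<Sum>xs\<in>paths R. \<Sum>ys\<in>paths (R - set xs). w s xs * w t ys * d (R - set xs - set ys)) +
        (\<Sum>(ys, zs)\<in>{(ys, zs). ys @ zs \<in> paths R}.
          (-1) ^ Suc (length ys + length zs) *
          qre (walk_prod M s (ys @ [t]) * walk_prod M t (zs @ [s])) * d (R - set ys - set zs))"
      if "s \<in> S" "t \<in> S" "s \<noteq> t" and R: "R = S - {s} - {t}" for s t
    proof -
      have fin: "finite (paths (S - {s}))" using psubset.hyps by (simp add: finite_paths)
      have "qre (?E S s) = (\<Sum>xs\<in>paths (S - {s}). w s xs * d (S - {s} - set xs))"
        using qre_E that(1) by blast
      also have "paths (S - {s}) = {xs \<in> paths (S - {s}). t \<notin> set xs} \<union> {xs \<in> paths (S - {s}). t \<in> set xs}"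
        by auto
      also have "(\<Sum>xs\<in>\<dots>. w s xs * d (S - {s} - set xs)) =
          (\<Sum>xs\<in>{xs \<in> paths (S - {s}). t \<notin> set xs}. w s xs * d (S - {s} - set xs)) +
          (\<Sum>xs\<in>{xs \<in> paths (S - {s}). t \<in> set xs}. w s xs * d (S - {s} - set xs))"
        using fin by (intro sum.union_disjoint) auto
      also have "(\<Sum>xs\<in>{xs \<in> paths (S - {s}). t \<notin> set xs}. w s xs * d (S - {s} - set xs)) =
          (\<Sum>xs\<in>paths R. \<Sum>ys\<in>paths (R - set xs). w s xs * w t ys * d (R - set xs - set ys))"
      proof (rule sum.cong)
        show "{xs \<in> paths (S - {s}). t \<notin> set xs} = paths R" by (auto simp: paths_def R)
        fix xs assume xs: "xs \<in> paths R"
        let ?B = "S - {s} - set xs"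
        have t: "t \<in> ?B" using xs that by (auto simp: paths_def)
        have B: "?B - {t} = R - set xs" using R by auto
        have "d ?B = qre (?E ?B t)"
          unfolding d_def using psubset.IH[OF sub[OF that(1)], of xs] t by simp
        also have "\<dots> = (\<Sum>ys\<in>paths (R - set xs). w t ys * d (R - set xs - set ys))"
          using qre_E[OF t] B by auto
        finally show "w s xs * d ?B =
            (\<Sum>ys\<in>paths (R - set xs). w s xs * w t ys * d (R - set xs - set ys))"
          by (simp add: sum_distrib_left mult.assoc)
      qed
      also have "(\<Sum>xs\<in>{xs \<in> paths (S - {s}). t \<in> set xs}. w s xs * d (S - {s} - set xs)) =
          (\<Sum>(ys, zs)\<in>{(ys, zs). ys @ zs \<in> paths R}. w s (ys @ t # zs) * d (S - {s} - set (ys @ t # zs)))"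
        unfolding R using psubset.hyps that by (intro sum_paths_through) auto
      also have "\<dots> = (\<Sum>(ys, zs)\<in>{(ys, zs). ys @ zs \<in> paths R}.
          (-1) ^ Suc (length ys + length zs) *
          qre (walk_prod M s (ys @ [t]) * walk_prod M t (zs @ [s])) * d (R - set ys - set zs))"
      proof (rule sum.cong[OF refl], clarify)
        fix ys zs
        have 1: "S - {s} - set (ys @ t # zs) = R - set ys - set zs" by (auto simp: R)
        have 2: "walk_prod M s ((ys @ t # zs) @ [s]) = walk_prod M s (ys @ [t]) * walk_prod M t (zs @ [s])"
          using walk_prod_append[of M s "ys @ [t]" "zs @ [s]"] by simp
        show "w s (ys @ t # zs) * d (S - {s} - set (ys @ t # zs)) = (-1) ^ Suc (length ys + length zs) *
          qre (walk_prod M s (ys @ [t]) * walk_prod M t (zs @ [s])) * d (R - set ys - set zs)"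
          unfolding w_def 1 2 by simp
      qed
      finally show ?thesis .
    qed
    \<comment> \<open>Disjointness of two paths is a symmetric condition, under which the order of
      summation can be exchanged.\<close>
    have paths_diff: "paths (R - set xs) = {ys \<in> paths R. set xs \<inter> set ys = {}}" for xs
      by (auto simp: paths_def)
    have sym1: "(\<Sum>xs\<in>paths R. \<Sum>ys\<in>paths (R - set xs). w s xs * w t ys * d (R - set xs - set ys)) =
        (\<Sum>xs\<in>paths R. \<Sum>ys\<in>paths (R - set xs). w t xs * w s ys * d (R - set xs - set ys))"
    proof -
      have "(\<Sum>xs\<in>paths R. \<Sum>ys\<in>paths (R - set xs). w s xs * w t ys * d (R - set xs - set ys)) =
          (\<Sum>ys\<in>paths R. \<Sum>xs\<in>paths (R - set ys). w s xs * w t ys * d (R - set xs - set ys))"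
        unfolding paths_diff
        by (subst sum.swap_restrict) (use finite_paths[OF finR] in \<open>auto simp: Int_commute\<close>)
      also have "\<dots> = (\<Sum>xs\<in>paths R. \<Sum>ys\<in>paths (R - set xs). w t xs * w s ys * d (R - set xs - set ys))"
      proof (intro sum.cong refl)
        fix ys xs
        have "R - set xs - set ys = R - set ys - set xs" by auto
        then show "w s xs * w t ys * d (R - set xs - set ys) = w t ys * w s xs * d (R - set ys - set xs)"
          by simp
      qed
      finally show ?thesis .
    qed
    have sym2: "(\<Sum>(ys, zs)\<in>{(ys, zs). ys @ zs \<in> paths R}.
          (-1) ^ Suc (length ys + length zs) *
          qre (walk_prod M s (ys @ [t]) * walk_prod M t (zs @ [s])) * d (R - set ys - set zs)) =
        (\<Sum>(ys, zs)\<in>{(ys, zs). ys @ zs \<in> paths R}.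
          (-1) ^ Suc (length ys + length zs) *
          qre (walk_prod M t (ys @ [s]) * walk_prod M s (zs @ [t])) * d (R - set ys - set zs))"
    \<comment> \<open>Exchanging the two pieces rotates the closed walk so that it starts at
      \<open>t\<close> instead of \<open>s\<close>.\<close>
    proof (rule sum.reindex_bij_witness[where i = prod.swap and j = prod.swap])
      fix a assume "a \<in> {(ys, zs). ys @ zs \<in> paths R}"
      obtain ys zs where a: "a = (ys, zs)" by (cases a)
      have "R - set zs - set ys = R - set ys - set zs" by auto
      then show "(case prod.swap a of (ys, zs) \<Rightarrow> (-1) ^ Suc (length ys + length zs) *
          qre (walk_prod M t (ys @ [s]) * walk_prod M s (zs @ [t])) * d (R - set ys - set zs)) =
          (case a of (ys, zs) \<Rightarrow> (-1) ^ Suc (length ys + length zs) *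
          qre (walk_prod M s (ys @ [t]) * walk_prod M t (zs @ [s])) * d (R - set ys - set zs))"
        unfolding a
        by (simp add: add.commute qre_mult_commute[of "walk_prod M t (zs @ [s])"])
    qed (auto simp: paths_def)
    have "R = S - {s} - {t}" "R = S - {t} - {s}" by (auto simp: R_def)
    then have "qre (?E S s) = qre (?E S t)"
      using split[of s t] split[of t s] st False unfolding sym1 sym2 by metis
    then show ?thesis using self_conj_eqI E_real st by blast
  qed simp
  show ?case
  proof (cases "S = {}")
    case True
    then show ?thesis by (simp add: pdet_def)
  next
    case False
    then have m: "Min S \<in> S" using psubset.hyps by simp
    have "pdet M S = ?E S (Min S)"
      using False cdet_eq_path_sum[OF psubset.hyps m] by (simp add: pdet_def)
    then show ?thesis using E_real[OF m] indep[OF _ m] by simp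
  qed
qed

lemma qcnj_pdet:
  assumes "hermitian M" "finite S"
  shows "qcnj (pdet M S) = pdet M S"
  using pdet_hermitian[OF assms] by blast

lemma closed_path_sum_hermitian:
  assumes "hermitian M" "finite S" "s \<in> S"
  shows "path_sum M (S - {s}) s (\<lambda>a. M a s) = pdet M S"
  using pdet_hermitian[OF assms(1,2)] assms(3) by blast

text \<open>A nonempty path is a first step to \<open>b\<close> followed by a path from
  \<open>b\<close> that avoids \<open>b\<close>. The entry \<open>M a b\<close> moves in front of
  the minors because these are real, and the extra step flips the sign.\<close>

lemma path_sum_rec:
  assumes "hermitian M" "finite S"
  shows "path_sum M S a g = pdet M S * g a - (\<Sum>b\<in>S. M a b * path_sum M (S - {b}) b g)"
proof -
  have "(-1) ^ length (b # ys) * (pdet M (S - set (b # ys)) * (walk_prod M a (b # ys) * g (last (a # b # ys))))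
     = - (M a b * ((-1) ^ length ys * (pdet M (S - {b} - set ys) * (walk_prod M b ys * g (last (b # ys))))))"
    for b ys
  proof -
    have r: "qcnj (pdet M (S - {b} - set ys)) = pdet M (S - {b} - set ys)"
      using assms by (intro qcnj_pdet) auto
    have "S - set (b # ys) = S - {b} - set ys" by auto
    then show ?thesis
      by (simp add: self_conj_left_commute[OF r, of "M a b"] self_conj_left_commute[OF qcnj_sign, of "M a b"] mult.assoc)
  qed
  then show ?thesis
    unfolding path_sum_def sum_paths_Cons[OF assms(2)]
    by (simp add: sum_distrib_left sum_negf)
qed

text \<open>For \<open>a\<close> outside \<open>S\<close> this is the vanishing of a determinant
  with two equal columns. In the recursion the terms with \<open>b\<close> different from
  \<open>i\<close> vanish by induction; the closed paths through \<open>i\<close> give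
  \<open>M a i * pdet M S\<close>, which cancels the leading term.\<close>

lemma path_sum_column_eq_0:
  assumes "hermitian M" "finite S" "i \<in> S"
  shows "path_sum M S a (\<lambda>c. M c i) = 0"
  using assms(2,3)
proof (induction S arbitrary: a rule: finite_psubset_induct)
  case (psubset S)
  have "path_sum M S a (\<lambda>c. M c i)
      = pdet M S * M a i - (\<Sum>b\<in>S. M a b * path_sum M (S - {b}) b (\<lambda>c. M c i))"
    by (rule path_sum_rec[OF assms(1) psubset.hyps])
  also have "(\<Sum>b\<in>S. M a b * path_sum M (S - {b}) b (\<lambda>c. M c i)) = (\<Sum>b\<in>S. if b = i then M a i * pdet M S else 0)"
  proof (rule sum.cong[OF refl])
    fix b assume b: "b \<in> S"
    then have "S - {b} \<subset> S" by auto
    then show "M a b * path_sum M (S - {b}) b (\<lambda>c. M c i) = (if b = i then M a i * pdet M S else 0)"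
      using psubset.IH[of "S - {b}" b] psubset.prems
        closed_path_sum_hermitian[OF assms(1) psubset.hyps psubset.prems]
      by (cases "b = i") auto
  qed
  also have "\<dots> = pdet M S * M a i"
    using psubset.hyps psubset.prems self_conj_commute[OF qcnj_pdet[OF assms(1) psubset.hyps]] by simp
  finally show ?case by simp
qed

text \<open>The entry in row \<open>j\<close> and column \<open>c\<close> of the adjugate of the
  submatrix on \<open>S\<close>: the indicator is a unit column put in place of column
  \<open>j\<close>.\<close>

definition path_kernel :: "(nat \<Rightarrow> nat \<Rightarrow> quat) \<Rightarrow> nat set \<Rightarrow> nat \<Rightarrow> nat \<Rightarrow> quat" where
  "path_kernel M S j c = path_sum M (S - {j}) j (\<lambda>x. if x = c then 1 else 0)"

lemma path_sum_eq_kernel: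
  assumes "finite S" "j \<in> S"
  shows "path_sum M (S - {j}) j g = (\<Sum>c\<in>S. path_kernel M S j c * g c)"
proof -
  have "(\<Sum>c\<in>S. path_kernel M S j c * g c) = (\<Sum>xs\<in>paths (S - {j}). \<Sum>c\<in>S.
      (-1) ^ length xs * (pdet M (S - {j} - set xs) * (walk_prod M j xs * ((if last (j # xs) = c then 1 else 0) * g c))))"
    unfolding path_kernel_def path_sum_def sum_distrib_right
    by (subst sum.swap) (simp only: mult.assoc)
  also have "\<dots> = path_sum M (S - {j}) j g"
    unfolding path_sum_def
  proof (rule sum.cong[OF refl])
    fix xs assume "xs \<in> paths (S - {j})"
    then have "set (j # xs) \<subseteq> S" using assms(2) by (auto simp: paths_def)
    then have "last (j # xs) \<in> S" using last_in_set[of "j # xs"] by blast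
    moreover have "(\<Sum>c\<in>S. (if last (j # xs) = c then 1 else 0) * g c)
        = (\<Sum>c\<in>S. if last (j # xs) = c then g c else 0)"
      by (rule sum.cong) auto
    ultimately have "(\<Sum>c\<in>S. (if last (j # xs) = c then 1 else 0) * g c) = g (last (j # xs))"
      using assms(1) by (simp only: sum.delta' if_True)
    then show "(\<Sum>c\<in>S. (-1) ^ length xs * (pdet M (S - {j} - set xs) * (walk_prod M j xs *
        ((if last (j # xs) = c then 1 else 0) * g c)))) =
      (-1) ^ length xs * (pdet M (S - {j} - set xs) * (walk_prod M j xs * g (last (j # xs))))"
      by (simp only: sum_distrib_left[symmetric])
  qed
  finally show ?thesis by simp
qed

text \<open>The indicator keeps the paths that end in \<open>c\<close>. With \<open>c\<close>
  stripped off, the rest is any path in \<open>S - {j, c}\<close>, and reversal becomes a symmetry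
  between \<open>j\<close> and \<open>c\<close>.\<close>

lemma path_kernel_eq:
  assumes "finite S" "j \<in> S" "c \<in> S" "j \<noteq> c"
  shows "path_kernel M S j c = (\<Sum>ys\<in>paths (S - {j, c}). (-1) ^ Suc (length ys) *
     (pdet M (S - {j, c} - set ys) * walk_prod M j (ys @ [c])))"
proof -
  let ?h = "\<lambda>ys. ys @ [c]"
  let ?G = "\<lambda>xs. (-1) ^ length xs * (pdet M (S - {j} - set xs) *
      (walk_prod M j xs * (if last (j # xs) = c then 1 else 0)))"
  have "path_kernel M S j c = (\<Sum>xs\<in>?h ` paths (S - {j, c}). ?G xs)"
    unfolding path_kernel_def path_sum_def
  proof (rule sum.mono_neutral_right)
    show "finite (paths (S - {j}))" using assms(1) by (simp add: finite_paths)
    show "?h ` paths (S - {j, c}) \<subseteq> paths (S - {j})" using assms by (auto simp: paths_def)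
    show "\<forall>xs\<in>paths (S - {j}) - ?h ` paths (S - {j, c}). ?G xs = 0"
    proof
      fix xs assume xs: "xs \<in> paths (S - {j}) - ?h ` paths (S - {j, c})"
      have "last (j # xs) \<noteq> c"
      proof
        assume l: "last (j # xs) = c"
        then have "xs \<noteq> []" using assms(4) by auto
        then have "xs = butlast xs @ [c]" using l append_butlast_last_id[of xs] by simp
        then obtain ys where "xs = ys @ [c]" by blast
        then show False using xs by (auto simp: paths_def)
      qed
      then show "?G xs = 0" by (simp only: if_False mult_zero_right)
    qed
  qed
  also have "\<dots> = (\<Sum>ys\<in>paths (S - {j, c}). ?G (?h ys))"
    by (subst sum.reindex) (auto simp: inj_on_def)
  also have "\<dots> = (\<Sum>ys\<in>paths (S - {j, c}). (-1) ^ Suc (length ys) *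
     (pdet M (S - {j, c} - set ys) * walk_prod M j (ys @ [c])))"
  proof (rule sum.cong[OF refl])
    fix ys
    have "S - {j} - set (ys @ [c]) = S - {j, c} - set ys" by auto
    then show "?G (?h ys) = (-1) ^ Suc (length ys) * (pdet M (S - {j, c} - set ys) * walk_prod M j (ys @ [c]))"
      by simp
  qed
  finally show ?thesis .
qed

lemma path_kernel_diag:
  assumes "finite S" "j \<in> S"
  shows "path_kernel M S j j = pdet M (S - {j})"
proof -
  have z: "(-1) ^ length xs * (pdet M (S - {j} - set xs) *
      (walk_prod M j xs * (if last (j # xs) = j then 1 else 0))) = 0"
    if "xs \<in> paths (S - {j}) - {[]}" for xs
  proof -
    have "last xs \<in> set xs" "j \<notin> set xs" using that by (auto simp: paths_def)
    then have "last (j # xs) \<noteq> j" using that by auto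
    then show ?thesis by (simp only: if_False mult_zero_right)
  qed
  have "path_kernel M S j j = (\<Sum>xs\<in>{[]}. (-1) ^ length xs * (pdet M (S - {j} - set xs) *
      (walk_prod M j xs * (if last (j # xs) = j then 1 else 0))))"
    unfolding path_kernel_def path_sum_def
    using assms(1) z by (intro sum.mono_neutral_right finite_paths) (auto simp: paths_def)
  then show ?thesis by simp
qed

text \<open>The adjugate is Hermitian: paths from \<open>j\<close> to \<open>c\<close> reverse into
  paths from \<open>c\<close> to \<open>j\<close>, and the real minors do not change.\<close>

lemma qcnj_path_kernel:
  assumes "hermitian M" "finite S" "j \<in> S" "c \<in> S"
  shows "qcnj (path_kernel M S j c) = path_kernel M S c j"
proof (cases "j = c")
  case True
  then show ?thesis using assms by (simp add: path_kernel_diag qcnj_pdet)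
next
  case False
  have "qcnj (path_kernel M S j c) = (\<Sum>ys\<in>paths (S - {j, c}). (-1) ^ Suc (length (rev ys)) *
     (pdet M (S - {j, c} - set (rev ys)) * walk_prod M c (rev ys @ [j])))"
    unfolding path_kernel_eq[OF assms(2-4) False] qcnj_sum
  proof (rule sum.cong[OF refl])
    fix ys
    have "qcnj (pdet M (S - {j, c} - set ys)) = pdet M (S - {j, c} - set ys)"
      using assms by (intro qcnj_pdet) auto
    then show "qcnj ((-1) ^ Suc (length ys) * (pdet M (S - {j, c} - set ys) * walk_prod M j (ys @ [c])))
        = (-1) ^ Suc (length (rev ys)) * (pdet M (S - {j, c} - set (rev ys)) * walk_prod M c (rev ys @ [j]))"
      by (simp only: qcnj_mult qcnj_sign qcnj_walk_prod[OF assms(1)] self_conj_commute length_rev set_rev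
           sign_commute)
  qed
  also have "\<dots> = path_kernel M S c j"
    by (subst sum_paths_rev) (use path_kernel_eq[OF assms(2,4,3)] False in \<open>simp add: insert_commute\<close>)
  finally show ?thesis .
qed

text \<open>The diagonal case is the expansion at \<open>j\<close>, the other one the vanishing for
  two equal columns.\<close>

lemma path_kernel_mult_left:
  assumes "hermitian M" "finite S" "i \<in> S" "j \<in> S"
  shows "(\<Sum>c\<in>S. path_kernel M S j c * M c i) = (if i = j then pdet M S else 0)"
proof -
  have "(\<Sum>c\<in>S. path_kernel M S j c * M c i) = path_sum M (S - {j}) j (\<lambda>c. M c i)"
    using path_sum_eq_kernel[OF assms(2,4)] by simp
  then show ?thesis
    using assms closed_path_sum_hermitian[OF assms(1,2,4)] path_sum_column_eq_0[of M "S - {j}" i]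
    by auto
qed

text \<open>Obtained by conjugating the left identity, as \<open>M\<close> and its adjugate are both
  Hermitian.\<close>

lemma path_kernel_mult_right:
  assumes "hermitian M" "finite S" "i \<in> S" "j \<in> S"
  shows "(\<Sum>c\<in>S. M i c * path_kernel M S c j) = (if i = j then pdet M S else 0)"
proof -
  have "(\<Sum>c\<in>S. M i c * path_kernel M S c j) = qcnj (\<Sum>c\<in>S. path_kernel M S j c * M c i)"
    unfolding qcnj_sum
    using assms by (intro sum.cong) (auto simp: qcnj_mult qcnj_path_kernel hermitian_def)
  then show ?thesis using path_kernel_mult_left[OF assms] qcnj_pdet[OF assms(1,2)] by simp
qed

text \<open>Cramer's rule in the form \<open>M adj(M) g = det(M) g\<close> for the submatrix on
  \<open>S\<close>.\<close>

lemma sum_mult_path_sum: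
  assumes "hermitian M" "finite S" "i \<in> S"
  shows "(\<Sum>j\<in>S. M i j * path_sum M (S - {j}) j g) = pdet M S * g i"
proof -
  have "(\<Sum>j\<in>S. M i j * path_sum M (S - {j}) j g) = (\<Sum>j\<in>S. \<Sum>c\<in>S. M i j * path_kernel M S j c * g c)"
    using assms(2) by (intro sum.cong refl) (simp add: path_sum_eq_kernel sum_distrib_left mult.assoc)
  also have "\<dots> = (\<Sum>c\<in>S. (\<Sum>j\<in>S. M i j * path_kernel M S j c) * g c)"
    by (subst sum.swap) (simp add: sum_distrib_right)
  also have "\<dots> = (\<Sum>c\<in>S. if i = c then pdet M S * g c else 0)"
    using assms by (intro sum.cong refl) (simp add: path_kernel_mult_right)
  finally show ?thesis using assms(2,3) by simp
qed

section \<open>Replaced columns and the row determinant\<close>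

lemma pdet_cong:
  assumes "finite S" "\<And>a b. a \<in> S \<Longrightarrow> b \<in> S \<Longrightarrow> N a b = M a b"
  shows "pdet N S = pdet M S"
  using assms
proof (induction S rule: finite_psubset_induct)
  case (psubset S)
  have walk: "walk_prod N a xs = walk_prod M a xs" if "a \<in> S" "set xs \<subseteq> S" for a xs
    using that psubset.prems by (induction xs arbitrary: a) auto
  show ?case
  proof (cases "S = {}")
    case False
    then have m: "Min S \<in> S" using psubset.hyps by simp
    have "path_sum N (S - {Min S}) (Min S) (\<lambda>a. N a (Min S)) = path_sum M (S - {Min S}) (Min S) (\<lambda>a. M a (Min S))"
      unfolding closed_path_sum_eq
    proof (rule sum.cong[OF refl])
      fix xs assume xs: "xs \<in> paths (S - {Min S})"
      have "pdet N (S - {Min S} - set xs) = pdet M (S - {Min S} - set xs)"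
        using m psubset.prems by (intro psubset.IH) auto
      moreover have "walk_prod N (Min S) (xs @ [Min S]) = walk_prod M (Min S) (xs @ [Min S])"
        using xs m by (intro walk) (auto simp: paths_def)
      ultimately show "(-1) ^ length xs * (pdet N (S - {Min S} - set xs) * walk_prod N (Min S) (xs @ [Min S]))
        = (-1) ^ length xs * (pdet M (S - {Min S} - set xs) * walk_prod M (Min S) (xs @ [Min S]))"
        by simp
    qed
    then show ?thesis using False cdet_eq_path_sum[OF psubset.hyps m] by (simp add: pdet_def)
  qed (simp add: pdet_def)
qed

lemma cdet_repl_col:
  assumes "finite S" "j \<in> S"
  shows "cdet S (repl_col M j g) j = path_sum M (S - {j}) j g"
proof -
  have walk: "walk_prod (repl_col M j g) a xs = walk_prod M a xs" if "j \<notin> set xs" for a xs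
    using that by (induction xs arbitrary: a) (auto simp: repl_col_def)
  have "pdet (repl_col M j g) (S - {j} - set xs) = pdet M (S - {j} - set xs)" for xs
    using assms(1) by (intro pdet_cong) (auto simp: repl_col_def)
  moreover have "j \<notin> set xs" if "xs \<in> paths (S - {j})" for xs
    using that by (auto simp: paths_def)
  moreover have "repl_col M j g a j = g a" for a by (simp add: repl_col_def)
  ultimately show ?thesis
    unfolding cdet_eq_path_sum[OF assms] path_sum_def
    by (intro sum.cong refl) (simp add: walk)
qed

text \<open>The row and column expansions at \<open>Min S\<close> differ only in the side on which
  the minor stands, and by induction that minor is the same real number.\<close>

lemma prdet_hermitian:
  assumes "hermitian M" "finite S"
  shows "prdet M S = pdet M S"
  using assms(2)
proof (induction S rule: finite_psubset_induct)
  case (psubset S)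
  show ?case
  proof (cases "S = {}")
    case False
    let ?s = "Min S"
    have m: "?s \<in> S" using psubset.hyps False by simp
    have "prdet M S = rdet S M ?s" using False by (simp add: prdet_def hdet_def)
    also have "\<dots> = path_sum M (S - {?s}) ?s (\<lambda>a. M a ?s)"
      unfolding rdet_eq_path_sum[OF psubset.hyps m] path_sum_def
    proof (rule sum.cong[OF refl])
      fix xs
      have "prdet M (S - {?s} - set xs) = pdet M (S - {?s} - set xs)"
        using m by (intro psubset.IH) auto
      moreover have "qcnj (pdet M (S - {?s} - set xs)) = pdet M (S - {?s} - set xs)"
        using assms(1) psubset.hyps by (intro qcnj_pdet) auto
      ultimately show "(-1) ^ length xs * (walk_prod M ?s xs * M (last (?s # xs)) ?s * prdet M (S - {?s} - set xs))
        = (-1) ^ length xs * (pdet M (S - {?s} - set xs) * (walk_prod M ?s xs * M (last (?s # xs)) ?s))"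
        by (simp only: self_conj_commute[of "pdet M (S - {?s} - set xs)"])
    qed
    also have "\<dots> = pdet M S" by (rule closed_path_sum_hermitian[OF assms(1) psubset.hyps m])
    finally show ?thesis .
  qed (simp add: pdet_def prdet_def)
qed

section \<open>Gram matrices\<close>

abbreviation (input) gram :: "nat \<Rightarrow> (nat \<Rightarrow> nat \<Rightarrow> quat) \<Rightarrow> nat \<Rightarrow> nat \<Rightarrow> quat" where
  "gram m A \<equiv> mat_mult m (conj_transpose A) A"

lemma hermitian_gram: "hermitian (gram m A)"
  by (simp add: hermitian_def mat_mult_def conj_transpose_def qcnj_sum qcnj_mult)

text \<open>The inner product of \<open>A v\<close> and \<open>A u\<close>. The index sets are
  separate so that \<open>v = 1\<close> on a singleton \<open>S\<close> reads off one entry of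
  \<open>A^* A u\<close>.\<close>

lemma gram_form:
  "(\<Sum>i\<in>S. qcnj (v i) * (\<Sum>j\<in>T. gram m A i j * u j)) =
     (\<Sum>t<m. qcnj (\<Sum>i\<in>S. A t i * v i) * (\<Sum>j\<in>T. A t j * u j))"
proof -
  have "(\<Sum>i\<in>S. qcnj (v i) * (\<Sum>j\<in>T. gram m A i j * u j)) =
      (\<Sum>i\<in>S. \<Sum>j\<in>T. \<Sum>t<m. qcnj (v i) * qcnj (A t i) * A t j * u j)"
    by (simp add: mat_mult_def conj_transpose_def sum_distrib_left sum_distrib_right mult.assoc)
  also have "\<dots> = (\<Sum>i\<in>S. \<Sum>t<m. \<Sum>j\<in>T. qcnj (v i) * qcnj (A t i) * A t j * u j)"
    by (intro sum.cong refl sum.swap)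
  also have "\<dots> = (\<Sum>t<m. \<Sum>i\<in>S. \<Sum>j\<in>T. qcnj (v i) * qcnj (A t i) * A t j * u j)"
    by (rule sum.swap)
  also have "\<dots> = (\<Sum>t<m. qcnj (\<Sum>i\<in>S. A t i * v i) * (\<Sum>j\<in>T. A t j * u j))"
    by (simp add: qcnj_sum qcnj_mult sum_product mult.assoc)
  finally show ?thesis .
qed

text \<open>By \<open>gram_form\<close> with \<open>u = v\<close>, the squared norm of
  \<open>A v\<close> is 0.\<close>

lemma gram_kernel:
  assumes "\<forall>i\<in>S. (\<Sum>j\<in>S. gram m A i j * v j) = 0" "t < m"
  shows "(\<Sum>j\<in>S. A t j * v j) = 0"
proof -
  let ?a = "\<lambda>t. \<Sum>j\<in>S. A t j * v j"
  have "(\<Sum>t<m. qnormsq (?a t)) = qre (\<Sum>i\<in>S. qcnj (v i) * (\<Sum>j\<in>S. gram m A i j * v j))"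
    unfolding gram_form qre_sum qre_qcnj_mult_self ..
  also have "\<dots> = 0" using assms(1) by simp
  finally have "\<forall>t\<in>{..<m}. qnormsq (?a t) = 0"
    by (subst (asm) sum_nonneg_eq_0_iff) auto
  then show ?thesis using assms(2) by simp
qed

text \<open>The sum equals the inner product of \<open>A h\<close> and \<open>A w\<close>, and
  \<open>A h = 0\<close>.\<close>

lemma gram_range_orthogonal_kernel:
  assumes "\<forall>i\<in>S. v i = (\<Sum>j\<in>S. gram m A i j * w j)"
    and "\<forall>i\<in>S. (\<Sum>j\<in>S. gram m A i j * h j) = 0"
  shows "(\<Sum>i\<in>S. qcnj (h i) * v i) = 0"
proof -
  have "(\<Sum>i\<in>S. qcnj (h i) * v i) = (\<Sum>i\<in>S. qcnj (h i) * (\<Sum>j\<in>S. gram m A i j * w j))"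
    using assms(1) by (intro sum.cong) auto
  also have "\<dots> = 0"
    unfolding gram_form using gram_kernel[OF assms(2)] by simp
  finally show ?thesis .
qed

text \<open>Such a \<open>v\<close> is orthogonal to itself.\<close>

lemma gram_range_inter_kernel:
  assumes "finite S" "\<forall>i\<in>S. v i = (\<Sum>j\<in>S. gram m A i j * w j)"
    and "\<forall>i\<in>S. (\<Sum>j\<in>S. gram m A i j * v j) = 0" "i \<in> S"
  shows "v i = 0"
proof -
  have "(\<Sum>i\<in>S. qnormsq (v i)) = 0"
    using gram_range_orthogonal_kernel[OF assms(2,3)]
    by (simp only: qre_qcnj_mult_self[symmetric] qre_sum[symmetric] qre_0)
  then show ?thesis using assms(1,4) by (subst (asm) sum_nonneg_eq_0_iff) auto
qed

text \<open>A nontrivial relation \<open>v\<close> among the columns satisfies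
  \<open>M v = 0\<close>; multiplying by the adjugate from the left gives
  \<open>pdet M S * v j = 0\<close> with \<open>v j\<close> nonzero.\<close>

lemma pdet_gram_dependent:
  assumes "finite S" "\<not> right_lin_indep_cols m A S"
  shows "pdet (gram m A) S = 0"
proof -
  let ?M = "gram m A"
  note herm = hermitian_gram[of m A]
  obtain v j where v: "\<forall>t<m. (\<Sum>i\<in>S. A t i * v i) = 0" and j: "j \<in> S" "v j \<noteq> 0"
    using assms(2) unfolding right_lin_indep_cols_def by blast
  have Mv: "(\<Sum>i\<in>S. ?M c i * v i) = 0" for c
  proof -
    have "(\<Sum>i\<in>S. ?M c i * v i) = (\<Sum>i\<in>{c}. qcnj (1 :: quat) * (\<Sum>j\<in>S. ?M i j * v j))" by simp
    also have "\<dots> = 0" using gram_form[of "\<lambda>_. 1" m A v S "{c}"] v by simp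
    finally show ?thesis .
  qed
  have "0 = (\<Sum>c\<in>S. path_kernel ?M S j c * (\<Sum>i\<in>S. ?M c i * v i))" by (simp add: Mv)
  also have "\<dots> = (\<Sum>c\<in>S. \<Sum>i\<in>S. path_kernel ?M S j c * ?M c i * v i)"
    by (simp add: sum_distrib_left mult.assoc)
  also have "\<dots> = (\<Sum>i\<in>S. (\<Sum>c\<in>S. path_kernel ?M S j c * ?M c i) * v i)"
    by (subst sum.swap) (simp add: sum_distrib_right)
  also have "\<dots> = (\<Sum>i\<in>S. if i = j then pdet ?M S * v i else 0)"
    using path_kernel_mult_left[OF herm assms(1) _ j(1)] by (intro sum.cong) auto
  also have "\<dots> = pdet ?M S * v j" using assms(1) j(1) by simp
  finally show ?thesis using self_conj_mult_eq_0[OF qcnj_pdet[OF herm assms(1)]] j(2) by metis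
qed

lemma right_lin_indep_cols_subset:
  assumes "right_lin_indep_cols m A S" "T \<subseteq> S" "finite S"
  shows "right_lin_indep_cols m A T"
  unfolding right_lin_indep_cols_def
proof (intro allI impI ballI)
  fix a j assume a: "\<forall>i<m. (\<Sum>j\<in>T. A i j * a j) = 0" and j: "j \<in> T"
  let ?b = "\<lambda>j. if j \<in> T then a j else 0"
  have "(\<Sum>j\<in>S. A i j * ?b j) = (\<Sum>j\<in>T. A i j * a j)" for i
    using assms(2,3) by (intro sum.mono_neutral_cong_right) auto
  then have "\<forall>i<m. (\<Sum>j\<in>S. A i j * ?b j) = 0" using a by simp
  then have "\<forall>j\<in>S. ?b j = 0"
    by (rule assms(1)[unfolded right_lin_indep_cols_def, THEN spec, of ?b, THEN mp])
  then show "a j = 0" using j assms(2) by (auto split: if_splits)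
qed

text \<open>For the column \<open>v = path_kernel M S \<cdot> j\<close> one has \<open>M v = det M \<cdot> e\<^sub>j\<close> and
  \<open>v\<^sub>j = pdet M (S - {j})\<close>, so \<open>v\<^sup>* M v\<close> is the product of two consecutive principal minors.\<close>

lemma pdet_gram_pos:
  assumes "finite S" "right_lin_indep_cols m A S"
  shows "0 < qre (pdet (gram m A) S)"
  using assms
proof (induction S rule: finite_induct)
  case empty
  then show ?case by (simp add: pdet_def)
next
  case (insert j S)
  let ?M = "gram m A" and ?S = "insert j S"
  note herm = hermitian_gram[of m A]
  have fin: "finite ?S" using insert.hyps by simp
  have pos: "0 < qre (pdet ?M S)"
    using insert.IH right_lin_indep_cols_subset[OF insert.prems _ fin] by blast
  define v where "v c = path_kernel ?M ?S c j" for c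
  have vj: "v j = pdet ?M S"
    unfolding v_def using path_kernel_diag[OF fin] insert.hyps by simp
  then have "v j \<noteq> 0" using pos by auto
  then obtain t where t: "t < m" "(\<Sum>i\<in>?S. A t i * v i) \<noteq> 0"
    using insert.prems unfolding right_lin_indep_cols_def by blast
  have "(\<Sum>i\<in>?S. qcnj (v i) * (\<Sum>c\<in>?S. ?M i c * v c)) = (\<Sum>i\<in>?S. if i = j then qcnj (v i) * pdet ?M ?S else 0)"
    unfolding v_def using path_kernel_mult_right[OF herm fin] by (intro sum.cong) auto
  also have "\<dots> = pdet ?M S * pdet ?M ?S"
    using fin vj qcnj_pdet[OF herm insert.hyps(1)] by (simp only: sum.delta) simp
  finally have "qre (pdet ?M S) * qre (pdet ?M ?S) = (\<Sum>t<m. qnormsq (\<Sum>i\<in>?S. A t i * v i))"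
    unfolding gram_form
    by (metis (no_types, lifting) qre_self_conj_mult qcnj_pdet[OF herm insert.hyps(1)] qre_sum
        qre_qcnj_mult_self sum.cong)
  also have "\<dots> > 0"
  proof (rule sum_pos2[of _ t])
    show "0 < qnormsq (\<Sum>i\<in>?S. A t i * v i)"
      using t(2) by (metis qnormsq_eq_0_iff qnormsq_nonneg less_eq_real_def)
  qed (use t in auto)
  finally show ?case using pos by (simp add: zero_less_mult_iff)
qed

lemma pdet_gram_nonneg:
  assumes "finite S"
  shows "0 \<le> qre (pdet (gram m A) S)"
  using pdet_gram_pos[OF assms] pdet_gram_dependent[OF assms] by (cases "right_lin_indep_cols m A S") force+

section \<open>Sums over principal submatrices\<close>

text \<open>For \<open>r = 0\<close> the convention \<open>pdet M {} = 1\<close> makes this 1, as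
  the recursion requires.\<close>

definition minor_sum :: "(nat \<Rightarrow> nat \<Rightarrow> quat) \<Rightarrow> nat \<Rightarrow> nat \<Rightarrow> quat" where
  "minor_sum M n r = (\<Sum>\<beta> | \<beta> \<subseteq> {..<n} \<and> card \<beta> = r. pdet M \<beta>)"

text \<open>By \<open>cdet_repl_col\<close> each summand is the column determinant with column
  \<open>i\<close> replaced by \<open>f\<close>, so this is the numerator of order
  \<open>r\<close>.\<close>

definition bordered_sum :: "(nat \<Rightarrow> nat \<Rightarrow> quat) \<Rightarrow> nat \<Rightarrow> (nat \<Rightarrow> quat) \<Rightarrow> nat \<Rightarrow> nat \<Rightarrow> quat" where
  "bordered_sum M n f r i =
     (\<Sum>\<beta> | \<beta> \<subseteq> {..<n} \<and> card \<beta> = r \<and> i \<in> \<beta>. path_sum M (\<beta> - {i}) i f)"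

text \<open>The Faddeev--Leverrier recursion for the coefficients of the adjugate of \<open>M + \<alpha> I\<close>
  applied to \<open>f\<close>.\<close>

lemma bordered_sum_recursion:
  assumes "hermitian M" "i < n"
  shows "(\<Sum>j<n. M i j * bordered_sum M n f r j) = minor_sum M n r * f i - bordered_sum M n f (Suc r) i"
proof -
  let ?B = "{\<beta>. \<beta> \<subseteq> {..<n} \<and> card \<beta> = r}"
  have finB: "finite ?B" by (rule finite_subset[of _ "Pow {..<n}"]) auto
  have finb: "finite \<beta>" if "\<beta> \<in> ?B" for \<beta> using that finite_subset by blast
  have "(\<Sum>j<n. M i j * bordered_sum M n f r j) =
      (\<Sum>j<n. \<Sum>\<beta>\<in>{\<beta> \<in> ?B. j \<in> \<beta>}. M i j * path_sum M (\<beta> - {j}) j f)"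
    unfolding bordered_sum_def by (simp add: sum_distrib_left)
  also have "\<dots> = (\<Sum>\<beta>\<in>?B. \<Sum>j\<in>{j \<in> {..<n}. j \<in> \<beta>}. M i j * path_sum M (\<beta> - {j}) j f)"
    using finB by (intro sum.swap_restrict) auto
  \<comment> \<open>For \<open>i\<close> in \<open>\<beta>\<close> the inner sum is Cramer's rule on
    \<open>\<beta>\<close>. For \<open>i\<close> outside, \<open>path_sum_rec\<close> leaves a path
    sum that belongs to the set \<open>insert i \<beta>\<close> of order
    \<open>r + 1\<close>.\<close>
  also have "\<dots> = (\<Sum>\<beta>\<in>?B. pdet M \<beta> * f i - (if i \<notin> \<beta> then path_sum M \<beta> i f else 0))"
  proof (rule sum.cong[OF refl])
    fix \<beta> assume b: "\<beta> \<in> ?B"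
    then have eq: "{j \<in> {..<n}. j \<in> \<beta>} = \<beta>" by auto
    show "(\<Sum>j\<in>{j \<in> {..<n}. j \<in> \<beta>}. M i j * path_sum M (\<beta> - {j}) j f)
        = pdet M \<beta> * f i - (if i \<notin> \<beta> then path_sum M \<beta> i f else 0)"
      unfolding eq using sum_mult_path_sum[OF assms(1) finb[OF b]] path_sum_rec[OF assms(1) finb[OF b], of i f]
      by auto
  qed
  also have "\<dots> = minor_sum M n r * f i - (\<Sum>\<beta>\<in>{\<beta> \<in> ?B. i \<notin> \<beta>}. path_sum M \<beta> i f)"
    unfolding minor_sum_def sum_distrib_right sum_subtractf using finB by (subst sum.inter_filter) auto
  also have "(\<Sum>\<beta>\<in>{\<beta> \<in> ?B. i \<notin> \<beta>}. path_sum M \<beta> i f) = bordered_sum M n f (Suc r) i"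
    unfolding bordered_sum_def
  proof (rule sum.reindex_bij_witness[where j = "insert i" and i = "\<lambda>\<beta>. \<beta> - {i}"])
    fix \<beta> assume b: "\<beta> \<in> {\<beta> \<in> ?B. i \<notin> \<beta>}"
    then show "insert i \<beta> \<in> {\<beta>. \<beta> \<subseteq> {..<n} \<and> card \<beta> = Suc r \<and> i \<in> \<beta>}"
      using assms(2) finb[of \<beta>] by simp
    show minus: "insert i \<beta> - {i} = \<beta>" using b by simp
    show "path_sum M (insert i \<beta> - {i}) i f = path_sum M \<beta> i f" unfolding minus ..
  next
    fix \<beta> assume b: "\<beta> \<in> {\<beta>. \<beta> \<subseteq> {..<n} \<and> card \<beta> = Suc r \<and> i \<in> \<beta>}"
    then show "insert i (\<beta> - {i}) = \<beta>" by blast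
    have "finite \<beta>" using b finite_subset by blast
    then show "\<beta> - {i} \<in> {\<beta> \<in> ?B. i \<notin> \<beta>}" using b by auto
  qed
  finally show ?thesis .
qed

section \<open>Rank and the minors of the Gram matrix\<close>

lemma qrank_props:
  assumes "qrank m n A = k"
  shows "\<exists>S\<subseteq>{..<n}. card S = k \<and> right_lin_indep_cols m A S"
    and "\<And>S. S \<subseteq> {..<n} \<Longrightarrow> right_lin_indep_cols m A S \<Longrightarrow> card S \<le> k"
proof -
  let ?C = "{card S | S. S \<subseteq> {..<n} \<and> right_lin_indep_cols m A S}"
  have "?C \<subseteq> card ` Pow {..<n}" by auto
  then have fin: "finite ?C" by (rule finite_subset) simp
  have "right_lin_indep_cols m A {}" by (simp add: right_lin_indep_cols_def)
  then have ne: "?C \<noteq> {}" by (auto intro!: exI[of _ "{}"])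
  show "\<exists>S\<subseteq>{..<n}. card S = k \<and> right_lin_indep_cols m A S"
    using Max_in[OF fin ne] assms unfolding qrank_def by auto
  show "card S \<le> k" if "S \<subseteq> {..<n}" "right_lin_indep_cols m A S" for S
    using Max_ge[OF fin, of "card S"] that assms unfolding qrank_def by auto
qed

text \<open>Index sets larger than the rank are dependent and have zero minor. At order
  \<open>k\<close> all minors are nonnegative, and an independent set of that size has a positive
  one.\<close>

lemma minor_sum_gram:
  assumes "qrank m n A = k"
  shows "k < r \<Longrightarrow> minor_sum (gram m A) n r = 0"
    and "0 < qre (minor_sum (gram m A) n k)"
    and "qcnj (minor_sum (gram m A) n r) = minor_sum (gram m A) n r"
proof -
  have fin: "finite \<beta>" if "\<beta> \<subseteq> {..<n}" for \<beta> using that finite_subset by blast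
  show "minor_sum (gram m A) n r = 0" if "k < r"
    unfolding minor_sum_def
  proof (rule sum.neutral, clarify)
    fix \<beta> assume b: "\<beta> \<subseteq> {..<n}" "r = card \<beta>"
    then have "\<not> right_lin_indep_cols m A \<beta>" using qrank_props(2)[OF assms b(1)] that by auto
    then show "pdet (gram m A) \<beta> = 0" using pdet_gram_dependent fin[OF b(1)] by blast
  qed
  show "qcnj (minor_sum (gram m A) n r) = minor_sum (gram m A) n r"
    unfolding minor_sum_def qcnj_sum using fin hermitian_gram by (intro sum.cong) (auto intro!: qcnj_pdet)
  obtain S where S: "S \<subseteq> {..<n}" "card S = k" "right_lin_indep_cols m A S"
    using qrank_props(1)[OF assms] by blast
  show "0 < qre (minor_sum (gram m A) n k)"
    unfolding minor_sum_def qre_sum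
  proof (rule sum_pos2[of _ S])
    show "finite {\<beta>. \<beta> \<subseteq> {..<n} \<and> card \<beta> = k}" by (rule finite_subset[of _ "Pow {..<n}"]) auto
  qed (use S fin pdet_gram_pos pdet_gram_nonneg in auto)
qed

lemma bordered_sum_gram:
  assumes "qrank m n A = k" "\<forall>i<n. (\<Sum>j<n. gram m A i j * x j) = f i"
  shows "\<exists>w. \<forall>i<n. bordered_sum (gram m A) n f r i = (\<Sum>j<n. gram m A i j * w j)"
    and "k < r \<Longrightarrow> i < n \<Longrightarrow> bordered_sum (gram m A) n f r i = 0"
    and "i < n \<Longrightarrow> (\<Sum>j<n. gram m A i j * bordered_sum (gram m A) n f k j) = minor_sum (gram m A) n k * f i"
proof -
  let ?M = "gram m A" and ?N = "bordered_sum (gram m A) n f" and ?e = "minor_sum (gram m A) n"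
  note rec = bordered_sum_recursion[OF hermitian_gram]
  have range: "\<exists>w. \<forall>i<n. ?N r i = (\<Sum>j<n. ?M i j * w j)" for r
  proof (cases r)
    case 0
    have "?N 0 i = 0" for i
      unfolding bordered_sum_def by (rule sum.neutral) (auto dest: finite_subset[of _ "{..<n}"])
    then show ?thesis using 0 by (intro exI[of _ "\<lambda>_. 0"]) simp
  next
    case (Suc s)
    \<comment> \<open>The recursion \<open>N_(s+1) = e_s f - M N_s\<close> with
      \<open>f = M x\<close> exhibits the preimage.\<close>
    have "?N r i = (\<Sum>j<n. ?M i j * (?e s * x j - ?N s j))" if "i < n" for i
    proof -
      have "(\<Sum>j<n. ?M i j * (?e s * x j - ?N s j)) = ?e s * (\<Sum>j<n. ?M i j * x j) - (\<Sum>j<n. ?M i j * ?N s j)"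
        by (simp add: right_diff_distrib sum_subtractf sum_distrib_left
            self_conj_left_commute[OF minor_sum_gram(3)[OF assms(1)]])
      then show ?thesis using rec[OF that, of m A f s] assms(2) that Suc by simp
    qed
    then show ?thesis by (intro exI[of _ "\<lambda>j. ?e s * x j - ?N s j"]) simp
  qed
  show "\<exists>w. \<forall>i<n. ?N r i = (\<Sum>j<n. ?M i j * w j)" by (rule range)
  have big: "?N r i = 0" if "n < r" for r i
    unfolding bordered_sum_def
  proof (rule sum.neutral, clarify)
    fix \<beta> :: "nat set" assume "\<beta> \<subseteq> {..<n}" "r = card \<beta>"
    then show "path_sum ?M (\<beta> - {i}) i f = 0" using that card_mono[of "{..<n}" \<beta>] by simp
  qed
  have "\<forall>i<n. ?N r i = 0" if "k < r" for r
  proof (cases "n < r")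
    case False
    then have "r \<le> Suc n" by simp
    then show ?thesis using that
    \<comment> \<open>Descent from \<open>n + 1\<close>, where no index sets exist. Above the rank
      \<open>e_r = 0\<close>, so the vanishing of \<open>N_(r+1)\<close> puts \<open>N_r\<close>
      into the kernel of \<open>M\<close>, while it also lies in the range.\<close>
    proof (induction r rule: inc_induct)
      case base
      then show ?case using big by simp
    next
      case (step r)
      have "?N (Suc r) i = 0" if "i < n" for i using step.IH step.prems that by simp
      then have "\<forall>i\<in>{..<n}. (\<Sum>j\<in>{..<n}. ?M i j * ?N r j) = 0"
        using rec[of _ n m A f r] minor_sum_gram(1)[OF assms(1) step.prems] by simp
      moreover obtain w where "\<forall>i<n. ?N r i = (\<Sum>j<n. ?M i j * w j)" using range by blast
      ultimately show ?case using gram_range_inter_kernel[of "{..<n}" "?N r" m A w] by simp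
    qed
  qed (use big in simp)
  then show zero: "k < r \<Longrightarrow> i < n \<Longrightarrow> ?N r i = 0" for r i by blast
  show "(\<Sum>j<n. ?M i j * ?N k j) = ?e k * f i" if "i < n"
    using rec[OF that, of m A f k] zero[of "Suc k" i] that by simp
qed

section \<open>Least squares solutions\<close>

lemma vnorm_le_iff: "vnorm n x \<le> vnorm n z \<longleftrightarrow> (\<Sum>i<n. qnormsq (x i)) \<le> (\<Sum>i<n. qnormsq (z i))"
  by (simp add: vnorm_def)

text \<open>A quadratic in \<open>s\<close> that vanishes at 0 and is never negative has slope 0
  there.\<close>

lemma linear_term_eq_0:
  fixes G H :: real
  assumes "\<And>s. 0 \<le> - 2 * s * G + s\<^sup>2 * H" "0 \<le> H"
  shows "G = 0"
proof -
  \<comment> \<open>The parabola is lowest at \<open>G / H\<close>; the added 1 covers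
    \<open>H = 0\<close>.\<close>
  let ?s = "G / (H + 1)"
  have G: "G = ?s * (H + 1)" using assms(2) by simp
  have "0 \<le> - 2 * ?s * (?s * (H + 1)) + ?s\<^sup>2 * H" using assms(1)[of ?s] G by simp
  also have "\<dots> = - (?s\<^sup>2 * (H + 2))" by (simp only: power2_eq_square) algebra
  finally have "?s\<^sup>2 * (H + 2) \<le> 0" by simp
  then have "?s\<^sup>2 \<le> 0" using assms(2) by (simp add: mult_le_0_iff)
  then show ?thesis using assms(2) by auto
qed

text \<open>The minimizer is varied along \<open>x - s g\<close> with real \<open>s\<close>, where
  \<open>g\<close> is \<open>A^*\<close> applied to the residual. The linear coefficient in
  \<open>s\<close> is -2 times the squared norm of \<open>g\<close>, so
  \<open>g = 0\<close>.\<close>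

lemma lsq_normal_equations:
  assumes "is_lsq_solution m n A y x" "i < n"
  shows "(\<Sum>j<n. gram m A i j * x j) = mat_vec m (conj_transpose A) y i"
proof -
  define r where "r t = mat_vec n A x t - y t" for t
  define g where "g i = (\<Sum>t<m. qcnj (A t i) * r t)" for i
  define a where "a t = (\<Sum>j<n. A t j * g j)" for t
  let ?G = "\<Sum>i<n. qnormsq (g i)" and ?H = "\<Sum>t<m. qnormsq (a t)"
  have inner: "(\<Sum>t<m. qre (qcnj (r t) * a t)) = ?G"
  proof -
    have "(\<Sum>t<m. qcnj (r t) * a t) = (\<Sum>j<n. \<Sum>t<m. qcnj (r t) * A t j * g j)"
      unfolding a_def by (subst sum.swap) (simp add: sum_distrib_left mult.assoc)
    also have "\<dots> = (\<Sum>j<n. qcnj (g j) * g j)"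
      unfolding g_def by (simp add: qcnj_sum qcnj_mult sum_distrib_right)
    finally show ?thesis
      unfolding qre_sum[symmetric] by (simp only: qre_sum qre_qcnj_mult_self)
  qed
  have ineq: "0 \<le> - 2 * s * ?G + s\<^sup>2 * ?H" for s
  proof -
    let ?z = "\<lambda>j. x j - g j * Quat s 0 0 0"
    have z: "mat_vec n A ?z t - y t = r t - a t * Quat s 0 0 0" for t
      unfolding r_def a_def mat_vec_def
      by (simp add: right_diff_distrib sum_subtractf sum_distrib_right mult.assoc)
    have "(\<Sum>t<m. qnormsq (r t)) \<le> (\<Sum>t<m. qnormsq (r t - a t * Quat s 0 0 0))"
      using assms(1)[unfolded is_lsq_solution_def vnorm_le_iff, THEN spec, of ?z]
      unfolding z r_def[symmetric] .
    also have "\<dots> = (\<Sum>t<m. qnormsq (r t)) - 2 * s * (\<Sum>t<m. qre (qcnj (r t) * a t)) + s\<^sup>2 * ?H"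
      unfolding qnormsq_diff_real_multiple by (simp add: sum.distrib sum_subtractf sum_distrib_left)
    finally show ?thesis unfolding inner by simp
  qed
  have "?G = 0" using ineq by (rule linear_term_eq_0) (simp add: sum_nonneg)
  then have "g i = 0" using assms(2) by (subst (asm) sum_nonneg_eq_0_iff) auto
  moreover have "g i = (\<Sum>j<n. gram m A i j * x j) - mat_vec m (conj_transpose A) y i"
  proof -
    have "(\<Sum>j<n. gram m A i j * x j) = (\<Sum>t<m. qcnj (A t i) * mat_vec n A x t)"
      using gram_form[of "\<lambda>_. 1" m A x "{..<n}" "{i}"] by (simp add: mat_vec_def)
    then show ?thesis
      unfolding g_def r_def by (simp add: right_diff_distrib sum_subtractf mat_vec_def conj_transpose_def)
  qed
  ultimately show ?thesis by simp
qed

text \<open>The difference \<open>h = z - x\<close> lies in the kernel of \<open>A\<close>, so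
  \<open>z\<close> is a least squares solution too. As \<open>z\<close> lies in the range of the
  Gram matrix, it is orthogonal to \<open>h\<close>, and the squared norm of \<open>x\<close> is
  that of \<open>z\<close> plus that of \<open>h\<close>. Minimality of \<open>x\<close> forces
  \<open>h = 0\<close>.\<close>

lemma lsq_least_norm_unique:
  assumes "is_lsq_least_norm m n A y x"
    and "\<forall>i<n. (\<Sum>j<n. gram m A i j * z j) = mat_vec m (conj_transpose A) y i"
    and "\<forall>i<n. z i = (\<Sum>j<n. gram m A i j * w j)"
    and "i < n"
  shows "x i = z i"
proof -
  have lsq: "is_lsq_solution m n A y x" using assms(1) by (simp add: is_lsq_least_norm_def)
  define h where "h i = z i - x i" for i
  have Mh: "\<forall>i\<in>{..<n}. (\<Sum>j\<in>{..<n}. gram m A i j * h j) = 0"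
    using assms(2) lsq_normal_equations[OF lsq]
    by (simp add: h_def right_diff_distrib sum_subtractf)
  have "mat_vec n A z t = mat_vec n A x t" if "t < m" for t
    using gram_kernel[OF Mh that] by (simp add: h_def right_diff_distrib sum_subtractf mat_vec_def)
  then have "vnorm m (\<lambda>t. mat_vec n A z t - y t) = vnorm m (\<lambda>t. mat_vec n A x t - y t)"
    unfolding vnorm_def by simp
  then have "is_lsq_solution m n A y z" using lsq unfolding is_lsq_solution_def by simp
  then have le: "(\<Sum>i<n. qnormsq (x i)) \<le> (\<Sum>i<n. qnormsq (z i))"
    using assms(1) unfolding is_lsq_least_norm_def vnorm_le_iff[symmetric] by blast
  \<comment> \<open>Orthogonality comes as \<open>h^* z\<close>, while the expansion below contains
    \<open>z^* h\<close>.\<close>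
  have "qcnj (\<Sum>i<n. qcnj (h i) * z i) = 0"
    using gram_range_orthogonal_kernel[of "{..<n}" z m A w h] assms(3) Mh by simp
  then have "(\<Sum>i<n. qre (qcnj (z i) * h i)) = 0"
    by (simp add: qcnj_sum qcnj_mult qre_sum[symmetric])
  moreover have "qnormsq (x i) = qnormsq (z i) - 2 * qre (qcnj (z i) * h i) + qnormsq (h i)" for i
    using qnormsq_diff_real_multiple[of "z i" "h i" 1] by (simp add: h_def one_quat_def[symmetric])
  ultimately have "(\<Sum>i<n. qnormsq (x i)) = (\<Sum>i<n. qnormsq (z i)) + (\<Sum>i<n. qnormsq (h i))"
    by (simp add: sum.distrib sum_subtractf sum_distrib_left[symmetric])
  then have "(\<Sum>i<n. qnormsq (h i)) = 0" using le by (simp add: order_antisym sum_nonneg)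
  then have "h i = 0" using assms(4) by (subst (asm) sum_nonneg_eq_0_iff) auto
  then show ?thesis by (simp add: h_def)
qed

text \<open>The quotient \<open>N_k / e_k\<close> solves the normal equations and lies in the range
  of the Gram matrix, so uniqueness identifies it with \<open>x\<close>.\<close>

lemma lsq_least_norm_eq:
  assumes "is_lsq_least_norm m n A y x" "qrank m n A = k" "i < n"
  defines "f \<equiv> mat_vec m (conj_transpose A) y"
  shows "x i = bordered_sum (gram m A) n f k i * qinv (minor_sum (gram m A) n k)"
proof -
  let ?M = "gram m A" and ?N = "bordered_sum (gram m A) n f" and ?e = "minor_sum (gram m A) n k"
  have normal: "\<forall>i<n. (\<Sum>j<n. ?M i j * x j) = f i"
    using lsq_normal_equations assms(1) unfolding f_def is_lsq_least_norm_def by blast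
  note b = bordered_sum_gram[OF assms(2) normal]
  have e: "qcnj ?e = ?e" "?e * qinv ?e = 1"
    using minor_sum_gram(2,3)[OF assms(2)] by (auto intro!: qinv_self_conj simp: less_imp_neq[symmetric])
  obtain w where w: "\<forall>i<n. ?N k i = (\<Sum>j<n. ?M i j * w j)" using b(1) by blast
  show ?thesis
  proof (rule lsq_least_norm_unique[OF assms(1) _ _ assms(3)])
    show "\<forall>i<n. (\<Sum>j<n. ?M i j * (?N k j * qinv ?e)) = mat_vec m (conj_transpose A) y i"
    proof (intro allI impI)
      fix i assume "i < n"
      then have "(\<Sum>j<n. ?M i j * (?N k j * qinv ?e)) = ?e * f i * qinv ?e"
        using b(3) by (simp add: mult.assoc[symmetric] sum_distrib_right[symmetric])
      also have "\<dots> = f i" using e by (metis mult.assoc mult_1_right self_conj_commute)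
      finally show "(\<Sum>j<n. ?M i j * (?N k j * qinv ?e)) = mat_vec m (conj_transpose A) y i"
        by (simp add: f_def)
    qed
    show "\<forall>i<n. ?N k i * qinv ?e = (\<Sum>j<n. ?M i j * (w j * qinv ?e))"
      using w by (simp add: mult.assoc[symmetric] sum_distrib_right[symmetric])
  qed
qed

theorem theorem5p3:
  fixes m n :: nat and A :: "nat \<Rightarrow> nat \<Rightarrow> quat" and y x0 :: "nat \<Rightarrow> quat"
  assumes lsq: "is_lsq_least_norm m n A y x0"
  defines "f \<equiv> mat_vec m (conj_transpose A) y"
    and "AA \<equiv> mat_mult m (conj_transpose A) A"
  shows "(qrank m n A = n \<longrightarrow>
            (\<forall>j<n. x0 j = qdiv (cdet {..<n} (repl_col AA j f) j) (ddet m n A)))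
       \<and> (\<forall>k. qrank m n A = k \<and> k \<le> m \<and> m < n \<longrightarrow>
            (\<forall>j<n. x0 j =
               qdiv (\<Sum>\<beta>\<in>{\<beta>. \<beta> \<subseteq> {..<n} \<and> card \<beta> = k \<and> j \<in> \<beta>}. cdet \<beta> (repl_col AA j f) j)
                    (\<Sum>\<beta>\<in>{\<beta>. \<beta> \<subseteq> {..<n} \<and> card \<beta> = k}. hdet \<beta> AA)))"
proof -
  have fin: "finite \<beta>" if "\<beta> \<subseteq> {..<n}" for \<beta> using that finite_subset by blast
  \<comment> \<open>Both parts of the theorem are instances of this formula.\<close>
  have general: "x0 j = qdiv (\<Sum>\<beta>\<in>{\<beta>. \<beta> \<subseteq> {..<n} \<and> card \<beta> = k \<and> j \<in> \<beta>}. cdet \<beta> (repl_col AA j f) j)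
                    (\<Sum>\<beta>\<in>{\<beta>. \<beta> \<subseteq> {..<n} \<and> card \<beta> = k}. hdet \<beta> AA)"
    if rank: "qrank m n A = k" and j: "j < n" for k j
  proof -
    have num: "(\<Sum>\<beta>\<in>{\<beta>. \<beta> \<subseteq> {..<n} \<and> card \<beta> = k \<and> j \<in> \<beta>}. cdet \<beta> (repl_col AA j f) j)
        = bordered_sum AA n f k j"
      unfolding bordered_sum_def using fin by (intro sum.cong refl) (auto intro!: cdet_repl_col)
    have x0: "x0 j = bordered_sum AA n f k j * qinv (minor_sum AA n k)"
      unfolding AA_def f_def by (rule lsq_least_norm_eq[OF lsq rank j])
    show ?thesis
    proof (cases "k = 0")
      \<comment> \<open>\<open>hdet {} AA\<close> is a junk value, but the numerator vanishes.\<close>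
      case True
      then have "{\<beta>. \<beta> \<subseteq> {..<n} \<and> card \<beta> = k \<and> j \<in> \<beta>} = {}"
        by (auto dest: fin)
      then show ?thesis
        using x0 unfolding num[symmetric] qdiv_def by (simp only: sum.empty mult_zero_left)
    next
      case False
      have "(\<Sum>\<beta>\<in>{\<beta>. \<beta> \<subseteq> {..<n} \<and> card \<beta> = k}. hdet \<beta> AA) = minor_sum AA n k"
        unfolding minor_sum_def
      proof (rule sum.cong[OF refl])
        fix \<beta> assume "\<beta> \<in> {\<beta>. \<beta> \<subseteq> {..<n} \<and> card \<beta> = k}"
        then have "\<beta> \<noteq> {}" "finite \<beta>" using False fin by auto
        then show "hdet \<beta> AA = pdet AA \<beta>"
          using prdet_hermitian[OF hermitian_gram, of \<beta> m A] by (simp add: prdet_def AA_def)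
      qed
      then show ?thesis using x0 unfolding num[symmetric] qdiv_def by simp
    qed
  qed
  have "x0 j = qdiv (cdet {..<n} (repl_col AA j f) j) (ddet m n A)"
    if "qrank m n A = n" "j < n" for j
  proof -
    \<comment> \<open>For \<open>k = n\<close> the only index set is the full one, so each sum has a
      single term.\<close>
    have full: "\<beta> \<subseteq> {..<n} \<and> card \<beta> = n \<longleftrightarrow> \<beta> = {..<n}" for \<beta>
      using card_subset_eq[of "{..<n}" \<beta>] by auto
    have "{\<beta>. \<beta> \<subseteq> {..<n} \<and> card \<beta> = n \<and> j \<in> \<beta>} = {{..<n}}" "{\<beta>. \<beta> \<subseteq> {..<n} \<and> card \<beta> = n} = {{..<n}}"
      using full that(2) by blast+
    then show ?thesis using general[OF that] by (simp add: ddet_def AA_def)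
  qed
  then show ?thesis using general by blast
qed

end
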